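(* Let $m,d\in\mathbb{N}$ and $s,\alpha\in\mathbb{R}$ with $0<m<s<d$ and $0<\alpha<1$. Then there exist constants $p=p(m,s,d,\alpha)>0$ and $c=c(m,s,d,\alpha)>0$ such that the following holds. If $\mu$ is a measure on $\mathbb{R}^d$, then for $\mu$ almost every $x\in\Omega_s(\mu)$ and for all large enough $N\in\mathbb{N}$ (depending on $x$) we have $$\inf_{\theta\in\mathbb{S}^{d-1},\,V\in G(d,d-m)}\frac{\mu\big(X(x,2^{-k},V,\alpha)\setminus H(x,\theta,\alpha)\big)}{\mu(B(x,2^{-k}))}>c\quad\text{for at least } pN\text{ values }k\in[N].\qquad( * )$$ For $\mu$ almost all $x\in\Omega^s(\mu)$ the estimate $( * )$ holds for infinitely many $N\in\mathbb{N}$.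
   Context: A measure on $\mathbb{R}^d$ means a Borel regular, locally finite outer measure with compact support. $B(x,r)$ is the closed ball with center $x$ and radius $r$. $[N]=\{1,\dots,N\}$. Local dimensions: $\overline{\dim}_{\mathrm{loc}}(\mu,x)=\limsup_{r\searrow0}\frac{\log\mu(B(x,r))}{\log r}$ and $\underline{\dim}_{\mathrm{loc}}(\mu,x)=\liminf_{r\searrow0}\frac{\log\mu(B(x,r))}{\log r}$. Set $\Omega^s(\mu)=\{x:\overline{\dim}_{\mathrm{loc}}(\mu,x)\ge s\}$ and $\Omega_s(\mu)=\{x:\underline{\dim}_{\mathrm{loc}}(\mu,x)\ge s\}$. Cones: $G(d,d-m)$ is the set of all $(d-m)$-dimensional linear subspaces of $\mathbb{R}^d$ and $\mathbb{S}^{d-1}$ is the unit sphere of $\mathbb{R}^d$. For $x\in\mathbb{R}^d$, $r>0$, $\theta\in\mathbb{S}^{d-1}$, $0\le\alpha\le1$ and $V\in G(d,d-m)$, $$H(x,\theta,\alpha)=\{y\in\mathbb{R}^d:(y-x)\cdot\theta>\alpha|y-x|\},$$ $$X(x,V,\alpha)=\{y\in\mathbb{R}^d:\operatorname{dist}(y-x,V)<\alpha|y-x|\},\qquad X(x,r,V,\alpha)=B(x,r)\cap X(x,V,\alpha).$$ *)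

theory Defs
  imports "HOL-Analysis.Analysis"
begin

text \<open>
  A measure is an outer measure, defined on all subsets. The library's
  \<^const>\<open>countably_subadditive\<close> only speaks about disjoint sequences; since
  \<^const>\<open>outer_measure_space\<close> also includes monotonicity, on the full power set this is
  the usual countable subadditivity.
\<close>

definition borel_regular :: "('a::topological_space set \<Rightarrow> ennreal) \<Rightarrow> bool" where
  "borel_regular \<mu> \<longleftrightarrow>
     sets borel \<subseteq> lambda_system UNIV (Pow UNIV) \<mu> \<and>
     (\<forall>A. \<exists>B\<in>sets borel. A \<subseteq> B \<and> \<mu> B = \<mu> A)"

definition measure_support :: "('a::metric_space set \<Rightarrow> ennreal) \<Rightarrow> 'a set" where
  "measure_support \<mu> = {x. \<forall>r>0. \<mu> (cball x r) > 0}"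

definition compact_borel_regular_measure :: "((real^'n) set \<Rightarrow> ennreal) \<Rightarrow> bool" where
  "compact_borel_regular_measure \<mu> \<longleftrightarrow>
     outer_measure_space (Pow UNIV) \<mu> \<and>
     borel_regular \<mu> \<and>
     (\<forall>x. \<exists>r>0. \<mu> (cball x r) < \<infinity>) \<and>
     compact (measure_support \<mu>)"

definition ae_on :: "('a set \<Rightarrow> ennreal) \<Rightarrow> 'a set \<Rightarrow> ('a \<Rightarrow> bool) \<Rightarrow> bool" where
  "ae_on \<mu> A P \<longleftrightarrow> \<mu> {x \<in> A. \<not> P x} = 0"

definition ennreal_ln :: "ennreal \<Rightarrow> ereal" where
  "ennreal_ln u =
     (if u = 0 then -\<infinity> else if u = \<infinity> then \<infinity> else ereal (ln (enn2real u)))"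

text \<open>
  The quotients are taken in \<^typ>\<open>ereal\<close>: if \<open>\<mu> (cball x r) = 0\<close> for some
  \<open>0 < r < 1\<close>, the quotient is \<open>-\<infinity>\<close> divided by a negative number, i.e. \<open>\<infinity>\<close>, so
  points outside the support have local dimension \<open>\<infinity>\<close>.
\<close>

definition upper_local_dim :: "((real^'n) set \<Rightarrow> ennreal) \<Rightarrow> real^'n \<Rightarrow> ereal" where
  "upper_local_dim \<mu> x =
     Limsup (at_right 0) (\<lambda>r. ennreal_ln (\<mu> (cball x r)) / ereal (ln r))"

definition lower_local_dim :: "((real^'n) set \<Rightarrow> ennreal) \<Rightarrow> real^'n \<Rightarrow> ereal" where
  "lower_local_dim \<mu> x =
     Liminf (at_right 0) (\<lambda>r. ennreal_ln (\<mu> (cball x r)) / ereal (ln r))"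

definition Omega_upper :: "real \<Rightarrow> ((real^'n) set \<Rightarrow> ennreal) \<Rightarrow> (real^'n) set" where
  "Omega_upper s \<mu> = {x. upper_local_dim \<mu> x \<ge> ereal s}"

definition Omega_lower :: "real \<Rightarrow> ((real^'n) set \<Rightarrow> ennreal) \<Rightarrow> (real^'n) set" where
  "Omega_lower s \<mu> = {x. lower_local_dim \<mu> x \<ge> ereal s}"

definition Grassmannian :: "nat \<Rightarrow> (real^'n) set set" where
  "Grassmannian k = {V. subspace V \<and> dim V = k}"

definition H_cone :: "real^'n \<Rightarrow> real^'n \<Rightarrow> real \<Rightarrow> (real^'n) set" where
  "H_cone x \<theta> \<alpha> = {y. (y - x) \<bullet> \<theta> > \<alpha> * norm (y - x)}"

definition X_cone :: "real^'n \<Rightarrow> (real^'n) set \<Rightarrow> real \<Rightarrow> (real^'n) set" where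
  "X_cone x V \<alpha> = {y. infdist (y - x) V < \<alpha> * norm (y - x)}"

definition X_cone_ball :: "real^'n \<Rightarrow> real \<Rightarrow> (real^'n) set \<Rightarrow> real \<Rightarrow> (real^'n) set" where
  "X_cone_ball x r V \<alpha> = cball x r \<inter> X_cone x V \<alpha>"

text \<open>
  In \<^typ>\<open>ennreal\<close> we have \<open>0 / 0 = 0\<close>. This convention only concerns centres \<open>x\<close> outside
  the support of \<open>\<mu>\<close>, which form a null set.
\<close>

definition cone_density :: "((real^'n) set \<Rightarrow> ennreal) \<Rightarrow> nat \<Rightarrow> real \<Rightarrow> real^'n \<Rightarrow> nat \<Rightarrow> ennreal"
  where
  "cone_density \<mu> m \<alpha> x k =
     (INF (\<theta>, V) \<in> sphere 0 1 \<times> Grassmannian (CARD('n) - m).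
        \<mu> (X_cone_ball x (1 / 2 ^ k) V \<alpha> - H_cone x \<theta> \<alpha>) / \<mu> (cball x (1 / 2 ^ k)))"

end

theory Submission
  imports Defs
begin

text \<open>
  Fix \<open>m < s' < s\<close> and let \<open>E N\<close> be the set of points \<open>x\<close> of the support with
  \<open>\<mu> (B(x, 2^-N)) \<le> 2^(-N s')\<close> for which fewer than \<open>p N\<close> of the scales \<open>k \<le> N\<close> have cone
  density above \<open>c\<close>. Since \<open>\<mu> (E N)\<close> decays geometrically, Borel--Cantelli yields both statements.

  For the decay, look at the scales \<open>2^-(iK)\<close> for a large block length \<open>K\<close>. A block is light at \<open>x\<close>
  if the mass of the ball drops by a factor \<open>c\<close> across it; the points with at least \<open>p N\<close> light blocks
  have balls of mass \<open>c^(pN)\<close> and are negligible by a crude count. On the remaining points all but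
  \<open>2 p N\<close> blocks are neither light nor good, so some cone \<open>X(x, V, \<alpha>) - H(x, \<theta>, \<alpha>)\<close> carries almost no
  mass and hence contains no point \<open>y\<close> with a heavy ball around it. If \<open>x\<close> and \<open>y\<close> share (approximately) the
  same \<open>V\<close> and \<open>\<theta>\<close>, then one of \<open>y - x\<close>, \<open>x - y\<close> has nonpositive inner product with \<open>\<theta>\<close>, so \<open>H\<close>
  becomes irrelevant and \<open>x - y\<close> is far from \<open>V\<close>: such points form a discretised Lipschitz graph over the
  \<open>m\<close>-dimensional complement of \<open>V\<close>, covered by about \<open>2^(Km)\<close> pieces per block. Altogether the
  points are covered by \<open>2^(N(m + \<epsilon>))\<close> balls of mass at most \<open>2^(-N s')\<close>.
\<close>

section \<open>Covering numbers\<close>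

text \<open>The pieces are arbitrary sets rather than balls: they can be cut down to the covered
  set, and each piece lies in the closed \<open>D\<close>-ball around any of its points.\<close>

definition covered :: "nat \<Rightarrow> real \<Rightarrow> 'a::metric_space set \<Rightarrow> bool" where
  "covered n D A \<longleftrightarrow> (\<exists>\<F>. finite \<F> \<and> card \<F> \<le> n \<and> A \<subseteq> \<Union>\<F> \<and> (\<forall>S\<in>\<F>. \<forall>x\<in>S. \<forall>y\<in>S. dist x y \<le> D))"

lemma covered_mono:
  assumes "covered n D A" "B \<subseteq> A" "n \<le> n'" "D \<le> D'"
  shows "covered n' D' B"
proof -
  obtain \<F> where "finite \<F>" "card \<F> \<le> n" "A \<subseteq> \<Union>\<F>" "\<And>S x y. S \<in> \<F> \<Longrightarrow> x \<in> S \<Longrightarrow> y \<in> S \<Longrightarrow> dist x y \<le> D"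
    using assms(1) unfolding covered_def by blast
  then show ?thesis
    unfolding covered_def using assms(2-4) by (intro exI[of _ \<F>]) force
qed

lemma covered_empty [simp]: "covered n D {}"
  unfolding covered_def by (rule exI[of _ "{}"]) auto

lemma covered_UN:
  assumes "finite I" "\<And>i. i \<in> I \<Longrightarrow> covered n D (A i)"
  shows "covered (card I * n) D (\<Union>i\<in>I. A i)"
proof -
  have "\<forall>i\<in>I. \<exists>\<F>. finite \<F> \<and> card \<F> \<le> n \<and> A i \<subseteq> \<Union>\<F> \<and> (\<forall>S\<in>\<F>. \<forall>x\<in>S. \<forall>y\<in>S. dist x y \<le> D)"
    using assms(2) unfolding covered_def by blast
  then obtain \<F> where \<F>: "\<And>i. i \<in> I \<Longrightarrow> finite (\<F> i) \<and> card (\<F> i) \<le> n \<and> A i \<subseteq> \<Union>(\<F> i) \<and>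
      (\<forall>S\<in>\<F> i. \<forall>x\<in>S. \<forall>y\<in>S. dist x y \<le> D)"
    by metis
  have "card (\<Union>i\<in>I. \<F> i) \<le> (\<Sum>i\<in>I. card (\<F> i))"
    by (rule card_UN_le[OF assms(1)])
  also have "\<dots> \<le> card I * n"
    using sum_bounded_above[of I "\<lambda>i. card (\<F> i)" n] \<F> by simp
  finally have "card (\<Union>i\<in>I. \<F> i) \<le> card I * n" .
  moreover have "(\<Union>i\<in>I. A i) \<subseteq> \<Union>(\<Union>i\<in>I. \<F> i)"
  proof
    fix x assume "x \<in> (\<Union>i\<in>I. A i)"
    then obtain i where "i \<in> I" "x \<in> A i" by blast
    moreover have "A i \<subseteq> \<Union>(\<F> i)" using \<F> \<open>i \<in> I\<close> by simp
    ultimately show "x \<in> \<Union>(\<Union>i\<in>I. \<F> i)" by blast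
  qed
  moreover have "\<forall>S\<in>(\<Union>i\<in>I. \<F> i). \<forall>x\<in>S. \<forall>y\<in>S. dist x y \<le> D"
    using \<F> by blast
  moreover have "finite (\<Union>i\<in>I. \<F> i)"
    using \<F> assms(1) by simp
  ultimately show ?thesis
    unfolding covered_def by blast
qed

lemma covered_Un:
  assumes "covered n D A" "covered k D B"
  shows "covered (n + k) D (A \<union> B)"
proof -
  obtain \<F> where \<F>: "finite \<F>" "card \<F> \<le> n" "A \<subseteq> \<Union>\<F>" "\<forall>S\<in>\<F>. \<forall>x\<in>S. \<forall>y\<in>S. dist x y \<le> D"
    using assms(1) unfolding covered_def by blast
  obtain \<G> where \<G>: "finite \<G>" "card \<G> \<le> k" "B \<subseteq> \<Union>\<G>" "\<forall>S\<in>\<G>. \<forall>x\<in>S. \<forall>y\<in>S. dist x y \<le> D"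
    using assms(2) unfolding covered_def by blast
  have "card (\<F> \<union> \<G>) \<le> n + k"
    using card_Un_le[of \<F> \<G>] \<F>(2) \<G>(2) by linarith
  moreover have "A \<union> B \<subseteq> \<Union>(\<F> \<union> \<G>)"
    using \<F>(3) \<G>(3) by (simp add: Union_Un_distrib sup.coboundedI1 sup.coboundedI2)
  moreover have "\<forall>S\<in>\<F> \<union> \<G>. \<forall>x\<in>S. \<forall>y\<in>S. dist x y \<le> D"
    using \<F>(4) \<G>(4) by (simp add: ball_Un)
  moreover have "finite (\<F> \<union> \<G>)"
    using \<F>(1) \<G>(1) by simp
  ultimately show ?thesis
    unfolding covered_def by (intro exI[of _ "\<F> \<union> \<G>"] conjI)
qed

text \<open>The engine of the multi-scale count. Each piece is first intersected with
  \<open>A\<close>, so only subsets of \<open>A\<close> have to be refined, and properties shared by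
  the points of \<open>A\<close> remain available at the next scale.\<close>

lemma covered_refine:
  assumes "covered n D A"
    and "\<And>S. S \<subseteq> A \<Longrightarrow> \<forall>x\<in>S. \<forall>y\<in>S. dist x y \<le> D \<Longrightarrow> covered k D' S"
  shows "covered (n * k) D' A"
proof -
  obtain \<F> where *: "finite \<F>" "card \<F> \<le> n" "A \<subseteq> \<Union>\<F>" "\<forall>S\<in>\<F>. \<forall>x\<in>S. \<forall>y\<in>S. dist x y \<le> D"
    using assms(1) unfolding covered_def by blast
  have "covered (card \<F> * k) D' (\<Union>S\<in>\<F>. A \<inter> S)"
    by (rule covered_UN[OF *(1)], rule assms(2)) (use *(4) in auto)
  moreover have "(\<Union>S\<in>\<F>. A \<inter> S) = A"
    using *(3) by blast
  ultimately show ?thesis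
    using *(2) by (auto elim!: covered_mono)
qed

lemma covered_fibres:
  assumes "finite Z" "f ` A \<subseteq> Z"
    and "\<And>x y. x \<in> A \<Longrightarrow> y \<in> A \<Longrightarrow> f x = f y \<Longrightarrow> dist x y \<le> D"
  shows "covered (card Z) D A"
  unfolding covered_def
proof (intro exI[of _ "(\<lambda>z. {x \<in> A. f x = z}) ` Z"] conjI)
  show "card ((\<lambda>z. {x \<in> A. f x = z}) ` Z) \<le> card Z"
    by (rule card_image_le[OF assms(1)])
  show "finite ((\<lambda>z. {x \<in> A. f x = z}) ` Z)"
    using assms(1) by simp
  show "A \<subseteq> \<Union>((\<lambda>z. {x \<in> A. f x = z}) ` Z)"
    using assms(2) by auto
  show "\<forall>S\<in>(\<lambda>z. {x \<in> A. f x = z}) ` Z. \<forall>x\<in>S. \<forall>y\<in>S. dist x y \<le> D"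
    using assms(3) by simp
qed

lemma finite_net:
  assumes "0 < \<tau>"
  obtains C :: "'a::euclidean_space set" where "finite C" "C \<subseteq> cball 0 1"
    "\<And>x. norm x \<le> 1 \<Longrightarrow> \<exists>c\<in>C. norm (c - x) \<le> \<tau>"
proof -
  have "cball (0::'a) 1 \<subseteq> (\<Union>c\<in>cball 0 1. ball c \<tau>)"
    using assms by force
  then obtain C :: "'a set" where C: "C \<subseteq> cball 0 1" "finite C" "cball 0 1 \<subseteq> (\<Union>c\<in>C. ball c \<tau>)"
    using compactE_image[OF compact_cball, of "cball 0 1" "\<lambda>c. ball c \<tau>"] by (metis open_ball)
  have "\<exists>c\<in>C. norm (c - x) \<le> \<tau>" if "norm x \<le> 1" for x
  proof -
    have "x \<in> cball 0 1" using that by simp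
    then obtain c where "c \<in> C" "x \<in> ball c \<tau>" using C(3) by blast
    then show ?thesis by (auto simp: dist_norm intro: less_imp_le)
  qed
  then show thesis using that C by blast
qed

text \<open>By scale invariance \<open>n\<close> depends only on \<open>\<kappa>\<close> and the
  space: after translation to a point of \<open>S\<close> and division by \<open>D\<close>, the set
  lies in the unit ball, where one fixed \<open>\<kappa> / 2\<close>-net serves for every
  \<open>D\<close>.\<close>

lemma covered_scale:
  assumes "0 < \<kappa>"
  obtains n where "n \<ge> 1" "\<And>D (S :: 'a::euclidean_space set). 0 < D \<Longrightarrow>
    \<forall>x\<in>S. \<forall>y\<in>S. dist x y \<le> D \<Longrightarrow> covered n (\<kappa> * D) S"
proof -
  obtain C :: "'a set" where C: "finite C" "C \<subseteq> cball 0 1"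
    "\<And>x. norm x \<le> 1 \<Longrightarrow> \<exists>c\<in>C. norm (c - x) \<le> \<kappa> / 2"
    by (rule finite_net[OF half_gt_zero[OF assms]]) blast
  have "covered (card C) (\<kappa> * D) S" if D: "0 < D" and S: "\<forall>x\<in>S. \<forall>y\<in>S. dist x y \<le> D"
    for D and S :: "'a set"
  proof (cases "S = {}")
    case False
    then obtain x0 where x0: "x0 \<in> S" by auto
    define z where "z x = (1/D) *\<^sub>R (x - x0)" for x
    have "norm (z x) \<le> 1" if "x \<in> S" for x
      using S x0 that D by (auto simp: z_def dist_norm)
    then have "\<forall>x\<in>S. \<exists>c\<in>C. norm (c - z x) \<le> \<kappa> / 2"
      using C(3) by blast
    then obtain f where f: "\<And>x. x \<in> S \<Longrightarrow> f x \<in> C" "\<And>x. x \<in> S \<Longrightarrow> norm (f x - z x) \<le> \<kappa> / 2"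
      by metis
    show ?thesis
    proof (rule covered_fibres[OF C(1)])
      show "f ` S \<subseteq> C" using f by auto
      fix x y assume xy: "x \<in> S" "y \<in> S" "f x = f y"
      have "norm (z x - z y) \<le> norm (f y - z y) + norm (f x - z x)"
        using norm_triangle_ineq4[of "f y - z y" "f x - z x"] xy(3) by simp
      also have "\<dots> \<le> \<kappa>" using f(2)[OF xy(1)] f(2)[OF xy(2)] by linarith
      finally have "norm (z x - z y) \<le> \<kappa>" .
      moreover have "z x - z y = (1/D) *\<^sub>R (x - y)"
        by (simp add: z_def flip: scaleR_diff_right)
      ultimately have "norm (x - y) / D \<le> \<kappa>"
        using D by simp
      then show "dist x y \<le> \<kappa> * D"
        using D by (simp add: dist_norm pos_divide_le_eq)
    qed
  qed auto
  \<comment> \<open>Adding 1 secures \<open>n \<ge> 1\<close>, so that powers of \<open>n\<close>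
    increase with the exponent in later counts.\<close>
  then have "covered (card C + 1) (\<kappa> * D) S"
    if "0 < D" "\<forall>x\<in>S. \<forall>y\<in>S. dist x y \<le> D" for D and S :: "'a set"
    using that by (meson covered_mono le_add1 order_refl subset_refl)
  then show thesis
    by (rule that[of "card C + 1", rotated]) simp_all
qed

lemma bounded_covered:
  fixes S :: "'a::euclidean_space set"
  assumes "bounded S" "0 < D"
  obtains n where "covered n D S"
proof -
  obtain B where B: "\<forall>x\<in>S. norm x \<le> B" using assms(1) unfolding bounded_iff by blast
  define E where "E = 2 * \<bar>B\<bar> + 1"
  have E: "E > 0" by (simp add: E_def)
  have "\<forall>x\<in>S. \<forall>y\<in>S. dist x y \<le> E"
  proof safe
    fix x y assume "x \<in> S" "y \<in> S"
    then have "norm x \<le> \<bar>B\<bar>" "norm y \<le> \<bar>B\<bar>" using B by fastforce+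
    then show "dist x y \<le> E" using norm_triangle_ineq4[of x y] unfolding E_def dist_norm by linarith
  qed
  moreover obtain n where "n \<ge> 1" "\<And>D' (S' :: 'a set). 0 < D' \<Longrightarrow>
    \<forall>x\<in>S'. \<forall>y\<in>S'. dist x y \<le> D' \<Longrightarrow> covered n (D / E * D') S'"
    by (rule covered_scale[OF divide_pos_pos[OF assms(2) E]]) blast
  ultimately have "covered n (D / E * E) S" using E by blast
  then show thesis using that E by simp
qed

text \<open>
  \<open>ty i x = None\<close> marks a step about which nothing is known at \<open>x\<close>.
\<close>

lemma covered_few_free_steps:
  fixes ty :: "nat \<Rightarrow> 'a::metric_space \<Rightarrow> 't option"
  assumes base: "covered n0 (D 0) S"
    and free: "\<And>i (A :: 'a set). \<forall>x\<in>A. \<forall>y\<in>A. dist x y \<le> D i \<Longrightarrow> covered G (D (Suc i)) A"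
    and typed: "\<And>i A t. t \<in> T \<Longrightarrow> A \<subseteq> S \<Longrightarrow> \<forall>x\<in>A. \<forall>y\<in>A. dist x y \<le> D i \<Longrightarrow>
      \<forall>x\<in>A. ty i x = Some t \<Longrightarrow> covered W (D (Suc i)) A"
    and T: "finite T" "\<And>i x. x \<in> S \<Longrightarrow> ty i x \<in> insert None (Some ` T)"
    and GW: "G \<ge> 1" "W \<ge> 1"
  shows "covered (n0 * ((card T + 1) * W) ^ I * G ^ g) (D I)
    {x \<in> S. card {i. i < I \<and> ty i x = None} \<le> g}"
proof (induction I arbitrary: g)
  case 0
  have "n0 * 1 \<le> n0 * G ^ g" using GW by (intro mult_left_mono) auto
  then show ?case using covered_mono[OF base, of S "n0 * G ^ g" "D 0"] by simp
next
  case (Suc I)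
  define Q where "Q J g = {x \<in> S. card {i. i < J \<and> ty i x = None} \<le> g}" for J g
  define M where "M = (card T + 1) * W"
  have cnt: "card {i. i < Suc I \<and> ty i x = None} =
      card {i. i < I \<and> ty i x = None} + (if ty I x = None then 1 else 0)" for x
  proof -
    have "{i. i < Suc I \<and> ty i x = None} =
      {i. i < I \<and> ty i x = None} \<union> (if ty I x = None then {I} else {})"
      by (auto simp: less_Suc_eq)
    also have "card \<dots> = card {i. i < I \<and> ty i x = None} + card (if ty I x = None then {I} else {})"
      by (rule card_Un_disjoint) auto
    finally show ?thesis by simp
  qed
  have typed_part: "covered (n0 * M ^ I * G ^ g * W) (D (Suc I)) {x \<in> Q I g. ty I x = Some t}"
    if "t \<in> T" for t
  proof (rule covered_refine)
    show "covered (n0 * M ^ I * G ^ g) (D I) {x \<in> Q I g. ty I x = Some t}"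
      by (rule covered_mono[OF Suc.IH[of g]]) (auto simp: Q_def M_def)
    fix A assume "A \<subseteq> {x \<in> Q I g. ty I x = Some t}" "\<forall>x\<in>A. \<forall>y\<in>A. dist x y \<le> D I"
    then show "covered W (D (Suc I)) A"
      using that by (intro typed[of t]) (auto simp: Q_def)
  qed
  have "covered (card T * (n0 * M ^ I * G ^ g * W)) (D (Suc I))
      (\<Union>t\<in>T. {x \<in> Q I g. ty I x = Some t})"
    by (rule covered_UN[OF T(1) typed_part])
  moreover have "covered (n0 * M ^ I * G ^ g) (D (Suc I)) {x \<in> Q (Suc I) g. ty I x = None}"
  proof (cases g)
    case 0
    then have "{x \<in> Q (Suc I) g. ty I x = None} = {}" by (auto simp: Q_def cnt)
    then show ?thesis by (simp only: covered_empty)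
  next
    \<comment> \<open>A free last step consumes one unit of the budget \<open>g\<close>, hence the
      induction hypothesis at \<open>g'\<close>; this is why \<open>g\<close> varies in the
      induction.\<close>
    case (Suc g')
    have "covered (n0 * M ^ I * G ^ g' * G) (D (Suc I)) (Q I g')"
    proof (rule covered_refine)
      show "covered (n0 * M ^ I * G ^ g') (D I) (Q I g')"
        by (rule covered_mono[OF Suc.IH[of g']]) (auto simp: Q_def M_def)
    qed (rule free)
    moreover have "{x \<in> Q (Suc I) g. ty I x = None} \<subseteq> Q I g'"
      by (auto simp: Q_def cnt Suc)
    ultimately show ?thesis
      by (rule covered_mono) (auto simp: Suc)
  qed
  ultimately have "covered (card T * (n0 * M ^ I * G ^ g * W) + n0 * M ^ I * G ^ g) (D (Suc I))
    ((\<Union>t\<in>T. {x \<in> Q I g. ty I x = Some t}) \<union> {x \<in> Q (Suc I) g. ty I x = None})"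
    by (rule covered_Un)
  then show ?case
  proof (rule covered_mono)
    show "{x \<in> S. card {i. i < Suc I \<and> ty i x = None} \<le> g}
      \<subseteq> (\<Union>t\<in>T. {x \<in> Q I g. ty I x = Some t}) \<union> {x \<in> Q (Suc I) g. ty I x = None}"
      using T(2)[of _ I] by (auto simp: Q_def cnt split: if_splits)
    \<comment> \<open>The typed points contribute the factor \<open>card T * W\<close>, the free
      ones the factor 1, since their \<open>G\<close> is already part of \<open>G ^ g\<close>. As
      \<open>W \<ge> 1\<close>, the sum is at most \<open>M\<close>.\<close>
    have "card T * (n0 * M ^ I * G ^ g * W) + n0 * M ^ I * G ^ g
      = n0 * M ^ I * G ^ g * (card T * W + 1)"
      by (simp add: algebra_simps)
    also have "\<dots> \<le> n0 * M ^ I * G ^ g * M"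
      by (rule mult_left_mono) (use GW(2) in \<open>simp_all add: M_def\<close>)
    finally show "card T * (n0 * M ^ I * G ^ g * W) + n0 * M ^ I * G ^ g
      \<le> n0 * ((card T + 1) * W) ^ Suc I * G ^ g"
      by (simp add: M_def mult_ac)
  qed simp
qed

section \<open>Outer measures\<close>

lemma outer_mono:
  assumes "outer_measure_space (Pow UNIV) \<mu>" "A \<subseteq> B"
  shows "\<mu> A \<le> (\<mu> B :: ennreal)"
  using assms by (auto simp: outer_measure_space_def increasing_def)

lemma outer_empty:
  assumes "outer_measure_space (Pow UNIV) \<mu>"
  shows "\<mu> {} = (0 :: ennreal)"
  using assms by (auto simp: outer_measure_space_def positive_def)

text \<open>Subadditivity is assumed for disjoint sequences; passing to \<open>disjointed A\<close>
  and using monotonicity gives it for all sequences.\<close>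

lemma outer_countable:
  assumes \<mu>: "outer_measure_space (Pow UNIV) \<mu>"
  shows "\<mu> (\<Union>i. A i) \<le> (\<Sum>i::nat. \<mu> (A i) :: ennreal)"
proof -
  have "\<mu> (\<Union>i. disjointed A i) \<le> (\<Sum>i. \<mu> (disjointed A i))"
    using \<mu> disjoint_family_disjointed[of A]
    by (auto simp: outer_measure_space_def countably_subadditive_def)
  also have "\<dots> \<le> (\<Sum>i. \<mu> (A i))"
    by (intro suminf_le allI outer_mono[OF \<mu>] disjointed_subset) auto
  finally show ?thesis by (simp add: UN_disjointed_eq)
qed

lemma outer_countable_null:
  assumes \<mu>: "outer_measure_space (Pow UNIV) \<mu>"
    and "countable I" "\<And>i. i \<in> I \<Longrightarrow> \<mu> (A i) = (0 :: ennreal)"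
  shows "\<mu> (\<Union>i\<in>I. A i) = 0"
proof (cases "I = {}")
  case False
  have "\<mu> (\<Union>n. A (from_nat_into I n)) \<le> (\<Sum>n. \<mu> (A (from_nat_into I n)))"
    by (rule outer_countable[OF \<mu>])
  also have "\<dots> = 0"
    using assms(3) from_nat_into[OF False] by simp
  also have "(\<Union>n. A (from_nat_into I n)) = (\<Union>i\<in>I. A i)"
    using range_from_nat_into[OF False assms(2)] by (metis image_image)
  finally show ?thesis by simp
qed (simp add: outer_empty[OF \<mu>])

lemma outer_Un:
  assumes \<mu>: "outer_measure_space (Pow UNIV) \<mu>"
  shows "\<mu> (A \<union> B) \<le> \<mu> A + (\<mu> B :: ennreal)"
proof -
  define C where "C i = (if i = 0 then A else if i = 1 then B else {})" for i :: nat
  have "A \<union> B = (\<Union>i. C i)"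
    by (auto simp: C_def split: if_splits)
  moreover have "(\<Sum>i. \<mu> (C i)) = (\<Sum>i\<in>{0,1}. \<mu> (C i))"
    by (rule suminf_finite) (auto simp: C_def outer_empty[OF \<mu>])
  ultimately show ?thesis
    using outer_countable[OF \<mu>, of C] by (simp add: C_def)
qed

lemma outer_UN_finite:
  assumes \<mu>: "outer_measure_space (Pow UNIV) \<mu>" and "finite I"
  shows "\<mu> (\<Union>i\<in>I. A i) \<le> (\<Sum>i\<in>I. \<mu> (A i) :: ennreal)"
  using assms(2)
proof induction
  case (insert i I)
  have "\<mu> (\<Union>i\<in>insert i I. A i) \<le> \<mu> (A i) + \<mu> (\<Union>i\<in>I. A i)"
    using outer_Un[OF \<mu>] by simp
  also have "\<dots> \<le> (\<Sum>i\<in>insert i I. \<mu> (A i))"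
    using insert by (simp add: add_left_mono)
  finally show ?case .
qed (simp add: outer_empty[OF \<mu>])

text \<open>A nonempty piece of \<open>A\<close> lies in the \<open>D\<close>-ball around one of its
  own points, so mass bounds are needed only for balls centred in \<open>A\<close>.\<close>

lemma outer_covered_le:
  assumes \<mu>: "outer_measure_space (Pow UNIV) \<mu>" and "covered n D A"
    and "\<And>x. x \<in> A \<Longrightarrow> \<mu> (cball x D) \<le> (b :: ennreal)"
  shows "\<mu> A \<le> of_nat n * b"
proof -
  obtain \<F> where \<F>: "finite \<F>" "card \<F> \<le> n" "A \<subseteq> \<Union>\<F>" "\<forall>S\<in>\<F>. \<forall>x\<in>S. \<forall>y\<in>S. dist x y \<le> D"
    using assms(2) unfolding covered_def by blast
  have "\<mu> (A \<inter> S) \<le> b" if "S \<in> \<F>" for S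
  proof (cases "A \<inter> S = {}")
    case False
    then obtain x where "x \<in> A" "x \<in> S" by blast
    moreover have "A \<inter> S \<subseteq> cball x D" using \<F>(4) that \<open>x \<in> S\<close> by auto
    ultimately show ?thesis by (intro order_trans[OF outer_mono[OF \<mu>] assms(3)])
  qed (simp add: outer_empty[OF \<mu>])
  then have *: "(\<Sum>S\<in>\<F>. \<mu> (A \<inter> S)) \<le> of_nat (card \<F>) * b"
    by (intro sum_bounded_above)
  have "(\<Union>S\<in>\<F>. A \<inter> S) = A"
    using \<F>(3) by blast
  then have "\<mu> A \<le> of_nat (card \<F>) * b"
    using order_trans[OF outer_UN_finite[OF \<mu> \<F>(1)] *] by simp
  also have "\<dots> \<le> of_nat n * b"
    using \<F>(2) by (intro mult_right_mono) auto
  finally show ?thesis .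
qed

text \<open>The first Borel--Cantelli lemma: the limsup set lies in every tail union, and the tails
  of a convergent series tend to 0.\<close>

lemma outer_limsup_null:
  assumes \<mu>: "outer_measure_space (Pow UNIV) \<mu>"
    and fin: "(\<Sum>i. \<mu> (E i) :: ennreal) \<noteq> top"
  shows "\<mu> {x. \<exists>\<^sub>F i in sequentially. x \<in> E i} = 0"
proof -
  have le: "\<mu> {x. \<exists>\<^sub>F i in sequentially. x \<in> E i} \<le> (\<Sum>i. \<mu> (E (i + n)))" for n
  proof -
    have "{x. \<exists>\<^sub>F i in sequentially. x \<in> E i} \<subseteq> (\<Union>i. E (i + n))"
    proof
      fix x assume "x \<in> {x. \<exists>\<^sub>F i in sequentially. x \<in> E i}"
      then obtain i where "i \<ge> n" "x \<in> E i"
        unfolding frequently_sequentially by blast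
      then have "x \<in> E ((i - n) + n)" by simp
      then show "x \<in> (\<Union>i. E (i + n))" by blast
    qed
    then show ?thesis
      by (rule order_trans[OF outer_mono[OF \<mu>] outer_countable[OF \<mu>]])
  qed
  define f where "f i = enn2real (\<mu> (E i))" for i
  have ftop: "\<mu> (E i) < top" for i
    using ennreal_suminf_lessD[of "\<lambda>i. \<mu> (E i)" top] fin by (simp add: top.not_eq_extremum)
  have f: "\<mu> (E i) = ennreal (f i)" "f i \<ge> 0" for i
    using ftop by (simp_all add: f_def)
  have sf: "summable f"
    using fin f by (intro summable_suminf_not_top) auto
  have "(\<lambda>n. ennreal (\<Sum>i. f (i + n))) \<longlonglongrightarrow> ennreal 0"
    by (intro tendsto_ennrealI suminf_exist_split2 sf)
  moreover have "(\<Sum>i. \<mu> (E (i + n))) = ennreal (\<Sum>i. f (i + n))" for n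
    unfolding f(1) using f(2) sf by (intro suminf_ennreal2) (auto simp: summable_iff_shift)
  ultimately have "(\<lambda>n. \<Sum>i. \<mu> (E (i + n))) \<longlonglongrightarrow> 0"
    by simp
  then have "\<mu> {x. \<exists>\<^sub>F i in sequentially. x \<in> E i} \<le> 0"
    using le by (intro Lim_bounded2) auto
  then show ?thesis by simp
qed

text \<open>Off the support every point has a null ball, and by Lindelof countably many of these
  suffice. The compact support itself is covered by finitely many balls of finite mass.\<close>

lemma compact_measure_facts:
  fixes \<mu> :: "(real^'n) set \<Rightarrow> ennreal"
  assumes "compact_borel_regular_measure \<mu>"
  shows compl_support_null: "\<mu> (- measure_support \<mu>) = 0" and total_mass_finite: "\<mu> UNIV < top"
proof -
  have \<mu>: "outer_measure_space (Pow UNIV) \<mu>"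
    and lf: "\<And>x. \<exists>r>0. \<mu> (cball x r) < \<infinity>"
    and K: "compact (measure_support \<mu>)"
    using assms unfolding compact_borel_regular_measure_def by auto
  let ?\<F> = "{ball x r | x r. \<mu> (ball x r) = 0}"
  obtain \<F> where \<F>: "\<F> \<subseteq> ?\<F>" "countable \<F>" "\<Union>\<F> = \<Union>?\<F>"
  proof (rule Lindelof[of ?\<F>])
    show "open S" if "S \<in> ?\<F>" for S
      using that by auto
  qed blast
  have "\<mu> (\<Union>S\<in>\<F>. S) = 0"
    using \<F>(1) by (intro outer_countable_null[OF \<mu> \<F>(2)]) auto
  moreover have "- measure_support \<mu> \<subseteq> \<Union>\<F>"
  proof
    fix x assume "x \<in> - measure_support \<mu>"
    then obtain r where r: "r > 0" "\<mu> (cball x r) = 0"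
      unfolding measure_support_def by (auto simp: not_less)
    then have "\<mu> (ball x r) = 0"
      using outer_mono[OF \<mu> ball_subset_cball[of x r]] by simp
    then have "ball x r \<in> ?\<F>" by blast
    moreover have "x \<in> ball x r" using r(1) by simp
    ultimately show "x \<in> \<Union>\<F>"
      unfolding \<F>(3) by (rule UnionI)
  qed
  ultimately show null: "\<mu> (- measure_support \<mu>) = 0"
    using outer_mono[OF \<mu>, of "- measure_support \<mu>" "\<Union>\<F>"] by simp
  obtain R where R: "\<And>x. R x > 0" "\<And>x. \<mu> (cball x (R x)) < \<infinity>"
    using lf by metis
  have "measure_support \<mu> \<subseteq> (\<Union>c\<in>UNIV. ball c (R c))"
  proof
    fix x show "x \<in> (\<Union>c\<in>UNIV. ball c (R c))" using R(1)[of x] by (intro UN_I[of x]) auto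
  qed
  then obtain C where C: "finite C" "measure_support \<mu> \<subseteq> (\<Union>c\<in>C. ball c (R c))"
    by (rule compactE_image[OF K open_ball]) blast
  have "\<mu> (\<Union>c\<in>C. ball c (R c)) \<le> (\<Sum>c\<in>C. \<mu> (ball c (R c)))"
    by (rule outer_UN_finite[OF \<mu> C(1)])
  also have "\<dots> \<le> (\<Sum>c\<in>C. \<mu> (cball c (R c)))"
    by (intro sum_mono outer_mono[OF \<mu>] ball_subset_cball)
  also have "\<dots> < top"
    using R(2) C(1) by (simp add: infinity_ennreal_def)
  finally have "\<mu> (measure_support \<mu>) < top"
    using outer_mono[OF \<mu> C(2)] by (rule le_less_trans[rotated])
  moreover have "\<mu> UNIV \<le> \<mu> (measure_support \<mu>) + \<mu> (- measure_support \<mu>)"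
    using outer_Un[OF \<mu>, of "measure_support \<mu>" "- measure_support \<mu>"] by (simp add: Compl_partition)
  ultimately show "\<mu> UNIV < top"
    using null by simp
qed

section \<open>Cones\<close>

text \<open>The \<open>b i\<close> form an orthonormal basis of the orthogonal complement of
  \<open>V\<close>. The component of \<open>v\<close> in that complement bounds the distance to
  \<open>V\<close>, and its norm is at most the sum of the absolute coordinates.\<close>

lemma infdist_le_orthonormal_coords:
  fixes V :: "(real^'n) set"
  assumes V: "V \<in> Grassmannian (CARD('n) - m)" and m: "m \<le> CARD('n)"
  obtains b :: "nat \<Rightarrow> real^'n" where "\<And>i. i < m \<Longrightarrow> norm (b i) = 1"
    "\<And>v. infdist v V \<le> (\<Sum>i<m. \<bar>v \<bullet> b i\<bar>)"
proof -
  have sV: "subspace V" and dV: "dim V = CARD('n) - m"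
    using V by (auto simp: Grassmannian_def)
  define W where "W = {y \<in> UNIV. \<forall>x\<in>V. orthogonal x y}"
  have "dim W + dim V = CARD('n)"
    unfolding W_def using dim_subspace_orthogonal_to_vectors[OF sV subspace_UNIV] by simp
  then have dW: "dim W = m" using dV m by simp
  have "subspace W"
    unfolding W_def subspace_def by (auto simp: orthogonal_clauses orthogonal_def inner_simps)
  then obtain B where B: "B \<subseteq> W" "pairwise orthogonal B" "\<And>x. x \<in> B \<Longrightarrow> norm x = 1"
    "independent B" "card B = m" "span B = W"
    using orthonormal_basis_subspace dW by metis
  have finB: "finite B" using B(4) independent_imp_finite by blast
  obtain b where b: "bij_betw b {0..<m} B"
    using ex_bij_betw_nat_finite[OF finB] B(5) by blast
  show thesis
  proof (rule that[of b])
    show "norm (b i) = 1" if "i < m" for i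
      using that b B(3) by (auto simp: bij_betw_def)
    fix v
    obtain y z where yz: "y \<in> span V" "\<And>w. w \<in> span V \<Longrightarrow> orthogonal z w" "v = y + z"
      using orthogonal_subspace_decomp_exists by blast
    have yV: "y \<in> V" using yz(1) sV by (metis span_eq_iff)
    have "z \<in> span B"
      unfolding B(6) W_def using yz(2) span_base by (auto simp: orthogonal_commute)
    \<comment> \<open>The remainder of the orthogonal expansion lies in \<open>span B\<close> and is
      orthogonal to \<open>span B\<close>, hence to itself, so it vanishes.\<close>
    then have "z - (\<Sum>u\<in>B. (u \<bullet> z / (u \<bullet> u)) *\<^sub>R u) \<in> span B"
      by (intro span_diff span_sum span_scale) (simp_all add: span_base)
    then have "orthogonal (z - (\<Sum>u\<in>B. (u \<bullet> z / (u \<bullet> u)) *\<^sub>R u))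
        (z - (\<Sum>u\<in>B. (u \<bullet> z / (u \<bullet> u)) *\<^sub>R u))"
      by (rule Gram_Schmidt_step[OF B(2)])
    then have "z = (\<Sum>u\<in>B. (u \<bullet> z / (u \<bullet> u)) *\<^sub>R u)"
      by (simp add: orthogonal_self)
    also have "norm \<dots> \<le> (\<Sum>u\<in>B. norm ((u \<bullet> z / (u \<bullet> u)) *\<^sub>R u))"
      by (rule norm_sum)
    also have "\<dots> = (\<Sum>u\<in>B. \<bar>v \<bullet> u\<bar>)"
    proof (rule sum.cong)
      fix u assume u: "u \<in> B"
      then have "y \<bullet> u = 0" using B(1) yV by (auto simp: W_def orthogonal_def)
      moreover have "u \<bullet> u = 1" using B(3)[OF u] by (simp add: norm_eq_1)
      ultimately show "norm ((u \<bullet> z / (u \<bullet> u)) *\<^sub>R u) = \<bar>v \<bullet> u\<bar>"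
        using B(3)[OF u] yz(3) by (simp add: inner_simps inner_commute)
    qed simp
    also have "\<dots> = (\<Sum>i<m. \<bar>v \<bullet> b i\<bar>)"
      using sum.reindex_bij_betw[OF b, of "\<lambda>u. \<bar>v \<bullet> u\<bar>"] by (simp add: atLeast0LessThan)
    finally have "norm z \<le> (\<Sum>i<m. \<bar>v \<bullet> b i\<bar>)" .
    moreover have "infdist v V \<le> dist v y"
      by (rule infdist_le[OF yV])
    ultimately show "infdist v V \<le> (\<Sum>i<m. \<bar>v \<bullet> b i\<bar>)"
      by (simp add: yz(3) dist_norm)
  qed
qed

text \<open>Stability of the cone conditions under small errors. With
  \<open>n = norm (y - x)\<close>, a point \<open>z\<close> of the ball has distance more than
  \<open>n / 2\<close> from \<open>x\<close>. The choice of \<open>\<tau>\<close> bounds the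
  distance of \<open>z - x\<close> from \<open>V\<close> by
  \<open>m * 3 * \<tau> * n = \<alpha> * n / 4\<close>, and its inner product with
  \<open>\<theta>\<close> by \<open>2 * \<tau> * n\<close>; both are small enough compared with
  \<open>\<alpha> * n / 2\<close>.\<close>

lemma cball_subset_cone:
  fixes V :: "(real^'n) set" and x y \<theta> \<theta>' :: "real^'n" and b q :: "nat \<Rightarrow> real^'n"
  assumes b: "\<And>i. i < m \<Longrightarrow> norm (b i) = 1" "\<And>v. infdist v V \<le> (\<Sum>i<m. \<bar>v \<bullet> b i\<bar>)"
    and q: "\<And>i. i < m \<Longrightarrow> norm (q i - b i) \<le> \<tau>" "\<And>i. i < m \<Longrightarrow> \<bar>(y - x) \<bullet> q i\<bar> \<le> \<rho>"
    and \<theta>: "norm \<theta> = 1" "norm (\<theta>' - \<theta>) \<le> \<tau>" "(y - x) \<bullet> \<theta>' \<le> 0"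
    and m: "0 < m" and \<alpha>: "0 < \<alpha>" "\<alpha> < 1" and \<tau>: "\<tau> = \<alpha> / (12 * real m)"
    and \<rho>: "0 < \<rho>" "\<rho> < \<tau> * norm (y - x)" "norm (y - x) + \<rho> \<le> r"
  shows "cball y \<rho> \<subseteq> X_cone_ball x r V \<alpha> - H_cone x \<theta> \<alpha>"
proof
  fix z assume "z \<in> cball y \<rho>"
  then have zy: "norm (z - y) \<le> \<rho>" by (simp add: dist_norm norm_minus_commute)
  define n where "n = norm (y - x)"
  have \<tau>0: "0 < \<tau>" "12 * (real m * \<tau>) = \<alpha>" using \<tau> m \<alpha> by auto
  have "1 * \<tau> \<le> real m * \<tau>"
    using \<tau>0(1) m by (intro mult_right_mono) auto
  then have "12 * \<tau> \<le> \<alpha>"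
    using \<tau>0(2) by simp
  then have \<tau>12: "12 * \<tau> \<le> \<alpha>" "\<tau> \<le> 1/12" using \<alpha> by linarith+
  have n0: "n > 0" using zero_less_mult_pos[OF less_trans[OF \<rho>(1,2)] \<tau>0(1)] by (simp add: n_def)
  have \<rho>n: "\<rho> \<le> \<tau> * n" "\<tau> * n \<le> n / 12"
    using \<rho>(2) \<tau>12(2) n0 mult_right_mono[of \<tau> "1/12" n] by (auto simp: n_def)
  have dec: "z - x = (z - y) + (y - x)" by simp
  have zx: "n / 2 < norm (z - x)" 
  proof -
    have "n - norm (z - y) \<le> norm (z - x)"
      using norm_triangle_ineq2[of "y - x" "y - z"] by (simp add: n_def norm_minus_commute)
    then show ?thesis using zy \<rho>n n0 by linarith
  qed
  have zxr: "norm (z - x) \<le> r"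
    using norm_triangle_ineq[of "z - y" "y - x"] zy \<rho>(3) by simp
  have cs: "\<bar>u \<bullet> v\<bar> \<le> a * c" if "norm u \<le> a" "norm v \<le> c" for u v :: "real^'n" and a c
  proof -
    have "norm u * norm v \<le> a * c"
      by (rule mult_mono[OF that]) (use order_trans[OF norm_ge_zero that(1)] in auto)
    then show ?thesis using Cauchy_Schwarz_ineq2[of u v] by linarith
  qed
  have coord: "\<bar>(z - x) \<bullet> b i\<bar> \<le> 3 * (\<tau> * n)" if i: "i < m" for i
  proof -
    \<comment> \<open>Three errors of size at most \<open>\<tau> * n\<close>: moving from
      \<open>z\<close> to \<open>y\<close>, the coordinate of \<open>y - x\<close> along
      \<open>q i\<close>, and replacing \<open>b i\<close> by \<open>q i\<close>.\<close>
    have "(z - x) \<bullet> b i = (z - y) \<bullet> b i + (y - x) \<bullet> q i - (y - x) \<bullet> (q i - b i)"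
      by (simp add: inner_simps)
    moreover have "\<bar>(z - y) \<bullet> b i\<bar> \<le> \<rho>"
      using Cauchy_Schwarz_ineq2[of "z - y" "b i"] b(1)[OF i] zy by simp
    moreover have "\<bar>(y - x) \<bullet> (q i - b i)\<bar> \<le> \<tau> * n"
      using cs[OF order_refl q(1)[OF i]] by (simp add: n_def mult.commute)
    ultimately show ?thesis using q(2)[OF i] \<rho>n(1) by linarith
  qed
  have "infdist (z - x) V \<le> (\<Sum>i<m. \<bar>(z - x) \<bullet> b i\<bar>)" by (rule b(2))
  also have "\<dots> \<le> real m * (3 * (\<tau> * n))"
    using sum_bounded_above[of "{..<m}" "\<lambda>i. \<bar>(z - x) \<bullet> b i\<bar>" "3 * (\<tau> * n)"] coord by simp
  also have "\<dots> = \<alpha> * (n / 4)" using \<tau>0(2) by (simp add: algebra_simps flip: \<tau>0(2))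
  also have "\<dots> < \<alpha> * norm (z - x)" using zx n0 \<alpha>(1) by (intro mult_strict_left_mono) auto
  finally have inX: "infdist (z - x) V < \<alpha> * norm (z - x)" .
  have "(z - x) \<bullet> \<theta> = (z - y) \<bullet> \<theta> + (y - x) \<bullet> \<theta>' - (y - x) \<bullet> (\<theta>' - \<theta>)"
    by (simp add: inner_simps)
  moreover have "\<bar>(z - y) \<bullet> \<theta>\<bar> \<le> \<rho>"
    using Cauchy_Schwarz_ineq2[of "z - y" \<theta>] \<theta>(1) zy by simp
  moreover have "\<bar>(y - x) \<bullet> (\<theta>' - \<theta>)\<bar> \<le> \<tau> * n"
    using cs[OF order_refl \<theta>(2)] by (simp add: n_def mult.commute)
  ultimately have "(z - x) \<bullet> \<theta> \<le> 2 * (\<tau> * n)"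
    using \<theta>(3) \<rho>n(1) by linarith
  also have "\<dots> \<le> \<alpha> * (n / 2)"
    using \<tau>12(1) n0 mult_right_mono[of "12 * \<tau>" \<alpha> n] \<tau>0 by (simp add: algebra_simps)
  also have "\<dots> \<le> \<alpha> * norm (z - x)"
    using zx \<alpha>(1) by (intro mult_left_mono) auto
  finally have notH: "(z - x) \<bullet> \<theta> \<le> \<alpha> * norm (z - x)" .
  show "z \<in> X_cone_ball x r V \<alpha> - H_cone x \<theta> \<alpha>"
    using zxr inX notH by (simp add: X_cone_ball_def X_cone_def H_cone_def dist_norm norm_minus_commute)
qed

section \<open>Points of the same type\<close>

text \<open>
  \<open>t\<close> is a pair consisting of an approximate orthonormal basis of the orthogonal complement of \<open>V\<close>
  and an approximation of \<open>\<theta>\<close>; taken from a finite net, only finitely many values occur.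
\<close>

definition bad_type ::
  "((real^'n) set \<Rightarrow> ennreal) \<Rightarrow> nat \<Rightarrow> real \<Rightarrow> real \<Rightarrow> ennreal \<Rightarrow> real^'n \<Rightarrow> nat \<Rightarrow> (real^'n) list \<times> (real^'n) \<Rightarrow> bool"
  where
  "bad_type \<mu> m \<alpha> \<tau> c x k t \<longleftrightarrow> (\<exists>\<theta> V b. norm \<theta> = 1 \<and> norm (snd t - \<theta>) \<le> \<tau> \<and>
     (\<forall>i<m. norm (b i) = 1 \<and> norm (fst t ! i - b i) \<le> \<tau>) \<and>
     (\<forall>v. infdist v V \<le> (\<Sum>i<m. \<bar>v \<bullet> b i\<bar>)) \<and>
     \<mu> (X_cone_ball x (1 / 2 ^ k) V \<alpha> - H_cone x \<theta> \<alpha>) < c * \<mu> (cball x (1 / 2 ^ k)))"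

lemma bad_type_exists:
  fixes \<mu> :: "(real^'n) set \<Rightarrow> ennreal"
  assumes m: "m \<le> CARD('n)" and less: "cone_density \<mu> m \<alpha> x k < c"
    and pos: "\<mu> (cball x (1 / 2 ^ k)) \<noteq> 0" and fin: "\<mu> (cball x (1 / 2 ^ k)) < top"
    and C: "\<And>u. norm u \<le> 1 \<Longrightarrow> \<exists>c\<in>C. norm (c - u) \<le> \<tau>"
  shows "\<exists>t \<in> {qs. set qs \<subseteq> C \<and> length qs = m} \<times> C. bad_type \<mu> m \<alpha> \<tau> c x k t"
proof -
  obtain \<theta> V where \<theta>: "norm \<theta> = 1" and V: "V \<in> Grassmannian (CARD('n) - m)"
    and "\<mu> (X_cone_ball x (1 / 2 ^ k) V \<alpha> - H_cone x \<theta> \<alpha>) / \<mu> (cball x (1 / 2 ^ k)) < c"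
    using less unfolding cone_density_def INF_less_iff by auto
  then have small: "\<mu> (X_cone_ball x (1 / 2 ^ k) V \<alpha> - H_cone x \<theta> \<alpha>) < c * \<mu> (cball x (1 / 2 ^ k))"
    using divide_less_ennreal[OF pos fin] by simp
  obtain b :: "nat \<Rightarrow> real^'n" where b: "\<And>i. i < m \<Longrightarrow> norm (b i) = 1"
    "\<And>v. infdist v V \<le> (\<Sum>i<m. \<bar>v \<bullet> b i\<bar>)"
    by (rule infdist_le_orthonormal_coords[OF V m]) blast
  obtain r where r: "\<And>u. norm u \<le> 1 \<Longrightarrow> r u \<in> C" "\<And>u. norm u \<le> 1 \<Longrightarrow> norm (r u - u) \<le> \<tau>"
    using C by metis
  show ?thesis
  proof (rule bexI[of _ "(map (\<lambda>i. r (b i)) [0..<m], r \<theta>)"])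
    show "bad_type \<mu> m \<alpha> \<tau> c x k (map (\<lambda>i. r (b i)) [0..<m], r \<theta>)"
      unfolding bad_type_def
      by (rule exI[of _ \<theta>], rule exI[of _ V], rule exI[of _ b]) (use \<theta> b r small in auto)
  qed (use \<theta> b r in auto)
qed

text \<open>If the two points were further apart, a small ball around \<open>y\<close> would fit
  into the nearly empty cone at \<open>x\<close>. Its mass would then be below \<open>c\<close>
  times that of a large ball around \<open>y\<close>, against \<open>heavy\<close>.\<close>

lemma dist_le_of_bad_type:
  fixes \<mu> :: "(real^'n) set \<Rightarrow> ennreal"
  assumes \<mu>: "outer_measure_space (Pow UNIV) \<mu>"
    and m: "0 < m" and \<alpha>: "0 < \<alpha>" "\<alpha> < 1" and \<tau>: "\<tau> = \<alpha> / (12 * real m)"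
    and K: "2 \<le> K" and bad: "bad_type \<mu> m \<alpha> \<tau> c x (Suc j) t"
    and heavy: "c * \<mu> (cball y (1 / 2 ^ j)) < \<mu> (cball y (1 / 2 ^ (j + K)))"
    and near: "dist x y \<le> 1 / 2 ^ (j + 2)"
    and coords: "\<And>i. i < m \<Longrightarrow> \<bar>(y - x) \<bullet> (fst t ! i)\<bar> \<le> 1 / 2 ^ (j + K)"
    and side: "(y - x) \<bullet> snd t \<le> 0"
  shows "dist x y \<le> 1 / 2 ^ (j + K) / \<tau>"
proof (rule ccontr)
  assume "\<not> dist x y \<le> 1 / 2 ^ (j + K) / \<tau>"
  moreover have \<tau>0: "0 < \<tau>" using \<tau> \<alpha> m by simp
  ultimately have "1 / 2 ^ (j + K) < norm (x - y) * \<tau>"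
    by (simp only: not_le pos_divide_less_eq dist_norm)
  then have far: "1 / 2 ^ (j + K) < \<tau> * norm (y - x)"
    by (simp only: norm_minus_commute[of y x] mult.commute[of \<tau>])
  obtain \<theta> V b where *: "norm \<theta> = 1" "norm (snd t - \<theta>) \<le> \<tau>"
     "\<And>i. i < m \<Longrightarrow> norm (b i) = 1" "\<And>i. i < m \<Longrightarrow> norm (fst t ! i - b i) \<le> \<tau>"
     "\<And>v. infdist v V \<le> (\<Sum>i<m. \<bar>v \<bullet> b i\<bar>)"
     "\<mu> (X_cone_ball x (1 / 2 ^ Suc j) V \<alpha> - H_cone x \<theta> \<alpha>) < c * \<mu> (cball x (1 / 2 ^ Suc j))"
    using bad unfolding bad_type_def by blast
  have "(2::real) ^ 2 \<le> 2 ^ K" using K by (intro power_increasing) auto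
  then have "1 / 2 ^ (j + K) \<le> (1 / 2 ^ (j + 2) :: real)"
    by (simp add: power_add field_simps)
  then have r: "norm (y - x) + 1 / 2 ^ (j + K) \<le> 1 / 2 ^ Suc j"
    using near by (simp add: dist_norm norm_minus_commute)
  have "cball y (1 / 2 ^ (j + K)) \<subseteq> X_cone_ball x (1 / 2 ^ Suc j) V \<alpha> - H_cone x \<theta> \<alpha>"
    by (rule cball_subset_cone[OF *(3,5,4) coords *(1,2) side m \<alpha> \<tau> _ far r]) auto
  then have "\<mu> (cball y (1 / 2 ^ (j + K))) \<le> \<mu> (X_cone_ball x (1 / 2 ^ Suc j) V \<alpha> - H_cone x \<theta> \<alpha>)"
    by (rule outer_mono[OF \<mu>])
  also have "\<dots> < c * \<mu> (cball x (1 / 2 ^ Suc j))" by (rule *(6))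
  also have "\<dots> \<le> c * \<mu> (cball y (1 / 2 ^ j))"
  \<comment> \<open>The cone sits at level \<open>Suc j\<close> rather than \<open>j\<close> to
    leave room for recentring: a radius \<open>1 / 2 ^ Suc j\<close> plus a distance
    \<open>1 / 2 ^ (j + 2)\<close> stays below \<open>1 / 2 ^ j\<close>.\<close>
  proof (intro mult_left_mono outer_mono[OF \<mu>] subsetI)
    fix z assume "z \<in> cball x (1 / 2 ^ Suc j)"
    moreover have "1 / (2 * 2 ^ j) + 1 / (4 * 2 ^ j) \<le> (1 / 2 ^ j :: real)"
      by (simp add: field_simps)
    ultimately show "z \<in> cball y (1 / 2 ^ j)"
      using near dist_triangle[of y z x] by (simp add: dist_commute)
  qed simp
  finally show False using heavy by simp
qed

text \<open>The discretised Lipschitz graph. Points are labelled by their coordinates along the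
  \<open>m\<close> approximate normals, rounded to scale \<open>\<rho>\<close>; there are at most
  \<open>(2 * 2 ^ K + 1) ^ m\<close> labels, whence the exponent \<open>m\<close>. Equal labels
  force distance at most \<open>\<rho> / \<tau>\<close>, and \<open>n\<close> pieces per label reach
  the next scale.\<close>

lemma typed_cell_covered:
  fixes \<mu> :: "(real^'n) set \<Rightarrow> ennreal"
  assumes \<mu>: "outer_measure_space (Pow UNIV) \<mu>"
    and m: "0 < m" and \<alpha>: "0 < \<alpha>" "\<alpha> < 1" and \<tau>: "\<tau> = \<alpha> / (12 * real m)"
    and K: "2 \<le> K"
    and n: "\<And>D (S :: (real^'n) set). 0 < D \<Longrightarrow> \<forall>x\<in>S. \<forall>y\<in>S. dist x y \<le> D \<Longrightarrow> covered n (\<tau> / 4 * D) S"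
    and t: "length (fst t) = m" "set (fst t) \<subseteq> cball 0 1"
    and bad: "\<And>x. x \<in> A \<Longrightarrow> bad_type \<mu> m \<alpha> \<tau> c x (Suc j) t"
    and heavy: "\<And>x. x \<in> A \<Longrightarrow> c * \<mu> (cball x (1 / 2 ^ j)) < \<mu> (cball x (1 / 2 ^ (j + K)))"
    and near: "\<forall>x\<in>A. \<forall>y\<in>A. dist x y \<le> 1 / 2 ^ (j + 2)"
  shows "covered ((2 * 2 ^ K + 1) ^ m * n) (1 / 2 ^ (j + K + 2)) A"
proof (cases "A = {}")
  case False
  then obtain x0 where x0: "x0 \<in> A" by blast
  have \<tau>0: "0 < \<tau>" using \<tau> \<alpha> m by simp
  define \<rho> :: real where "\<rho> = 1 / 2 ^ (j + K)"
  have \<rho>: "0 < \<rho>" by (simp add: \<rho>_def)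
  \<comment> \<open>Subtracting the rounded coordinates of \<open>x0\<close> makes the range of
    labels independent of the position of the cell.\<close>
  define f where "f x = map (\<lambda>q. \<lfloor>x \<bullet> q / \<rho>\<rfloor> - \<lfloor>x0 \<bullet> q / \<rho>\<rfloor>) (fst t)" for x
  define Z where "Z = {l. set l \<subseteq> {- (2 ^ K) .. 2 ^ K :: int} \<and> length l = m}"
  have finZ: "finite Z" unfolding Z_def by (intro finite_lists_length_eq) simp
  have cardZ: "card Z = (2 * 2 ^ K + 1) ^ m"
  proof -
    have "card {- (2 ^ K) .. 2 ^ K :: int} = 2 * 2 ^ K + 1"
      by (simp add: nat_add_distrib nat_mult_distrib nat_power_eq)
    then show ?thesis unfolding Z_def by (subst card_lists_length_eq) auto
  qed
  have fl: "\<bar>real_of_int (\<lfloor>a\<rfloor> - \<lfloor>b\<rfloor>)\<bar> \<le> \<bar>a - b\<bar> + 1" for a b :: real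
    by linarith
  have "covered (card Z) (\<rho> / \<tau>) A"
  proof (rule covered_fibres[OF finZ])
    show "f ` A \<subseteq> Z"
    proof safe
      fix x assume x: "x \<in> A"
      have "\<lfloor>x \<bullet> q / \<rho>\<rfloor> - \<lfloor>x0 \<bullet> q / \<rho>\<rfloor> \<in> {- (2 ^ K) .. 2 ^ K}" if q: "q \<in> set (fst t)" for q
      proof -
        have "norm (x - x0) * norm q \<le> (1 / 2 ^ (j + 2)) * 1"
          using near x x0 q t(2) by (intro mult_mono) (auto simp: dist_norm)
        then have "\<bar>(x - x0) \<bullet> q\<bar> \<le> 1 / 2 ^ (j + 2)"
          using Cauchy_Schwarz_ineq2[of "x - x0" q] by linarith
        then have "\<bar>(x - x0) \<bullet> q\<bar> / \<rho> \<le> (1 / 2 ^ (j + 2)) / \<rho>"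
          using \<rho> by (intro divide_right_mono) auto
        also have "\<dots> = 2 ^ K / 4" by (simp add: \<rho>_def power_add)
        finally have "\<bar>x \<bullet> q / \<rho> - x0 \<bullet> q / \<rho>\<bar> \<le> 2 ^ K / 4"
          using \<rho> by (simp add: inner_diff_left diff_divide_distrib[symmetric])
        \<comment> \<open>From \<open>2 ^ K \<ge> 4\<close> the rounding error 1 is absorbed:
          \<open>2 ^ K / 4 + 1 \<le> 2 ^ K\<close>.\<close>
        moreover have "(2::real) ^ 2 \<le> 2 ^ K" using K by (intro power_increasing) auto
        ultimately have "\<bar>real_of_int (\<lfloor>x \<bullet> q / \<rho>\<rfloor> - \<lfloor>x0 \<bullet> q / \<rho>\<rfloor>)\<bar> \<le> 2 ^ K"
          using fl[of "x \<bullet> q / \<rho>" "x0 \<bullet> q / \<rho>"] by simp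
        then have "\<bar>real_of_int (\<lfloor>x \<bullet> q / \<rho>\<rfloor> - \<lfloor>x0 \<bullet> q / \<rho>\<rfloor>)\<bar> \<le> real_of_int (2 ^ K)"
          by simp
        then have "\<bar>\<lfloor>x \<bullet> q / \<rho>\<rfloor> - \<lfloor>x0 \<bullet> q / \<rho>\<rfloor>\<bar> \<le> 2 ^ K"
          by (simp only: of_int_abs[symmetric] of_int_le_iff)
        then show ?thesis by auto
      qed
      then show "f x \<in> Z" using t(1) by (auto simp: Z_def f_def)
    qed
    fix x y assume x: "x \<in> A" and y: "y \<in> A" and fxy: "f x = f y"
    have "\<bar>(y - x) \<bullet> (fst t ! i)\<bar> \<le> \<rho>" if "i < m" for i
    proof -
      have "f x ! i = f y ! i" using fxy by simp
      then have "\<lfloor>x \<bullet> fst t ! i / \<rho>\<rfloor> = \<lfloor>y \<bullet> fst t ! i / \<rho>\<rfloor>"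
        using that t(1) by (simp add: f_def)
      then have "\<bar>y \<bullet> fst t ! i / \<rho> - x \<bullet> fst t ! i / \<rho>\<bar> \<le> 1"
        by linarith
      then have "\<bar>(y - x) \<bullet> fst t ! i / \<rho>\<bar> \<le> 1"
        by (simp add: inner_diff_left diff_divide_distrib)
      then show ?thesis using \<rho> by (simp add: abs_divide)
    qed
    then have cyx: "\<bar>(y - x) \<bullet> (fst t ! i)\<bar> \<le> 1 / 2 ^ (j + K)" if "i < m" for i
      using that by (simp add: \<rho>_def)
    then have cxy: "\<bar>(x - y) \<bullet> (fst t ! i)\<bar> \<le> 1 / 2 ^ (j + K)" if "i < m" for i
      using that by (simp add: inner_diff_left abs_minus_commute)
    note D = dist_le_of_bad_type[OF \<mu> m \<alpha> \<tau> K bad heavy]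
    \<comment> \<open>exchanging \<open>x\<close> and \<open>y\<close> if necessary, the other point avoids the half-space cone \<open>H\<close>\<close>
    consider "(y - x) \<bullet> snd t \<le> 0" | "(x - y) \<bullet> snd t \<le> 0"
      by (auto simp: inner_diff_left) linarith
    then show "dist x y \<le> \<rho> / \<tau>"
    proof cases
      case 1
      have "dist x y \<le> 1 / 2 ^ (j + K) / \<tau>"
        by (rule D[OF x y _ cyx 1]) (use near x y in auto)
      then show ?thesis by (simp add: \<rho>_def)
    next
      case 2
      have "dist y x \<le> 1 / 2 ^ (j + K) / \<tau>"
        by (rule D[OF y x _ cxy 2]) (use near x y in auto)
      then show ?thesis by (simp add: \<rho>_def dist_commute)
    qed
  qed
  then have "covered (card Z * n) (\<tau> / 4 * (\<rho> / \<tau>)) A"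
  proof (rule covered_refine)
    show "covered n (\<tau> / 4 * (\<rho> / \<tau>)) S" if "\<forall>x\<in>S. \<forall>y\<in>S. dist x y \<le> \<rho> / \<tau>" for S :: "(real^'n) set"
      using that \<rho> \<tau>0 by (intro n) auto
  qed
  moreover have "\<tau> / 4 * (\<rho> / \<tau>) = 1 / 2 ^ (j + K + 2)"
    using \<tau>0 by (simp add: \<rho>_def power_add)
  ultimately show ?thesis by (simp add: cardZ)
qed simp

text \<open>Telescoping over the blocks: a light block contributes a factor \<open>c\<close>, any
  other block only monotonicity.\<close>

lemma mass_le_of_light_blocks:
  assumes \<mu>: "outer_measure_space (Pow UNIV) (\<mu> :: 'a::metric_space set \<Rightarrow> ennreal)"
  shows "\<mu> (cball x (1 / 2 ^ (I * K))) \<le>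
    c ^ card {i. i < I \<and> \<mu> (cball x (1 / 2 ^ (Suc i * K))) \<le> c * \<mu> (cball x (1 / 2 ^ (i * K)))}
      * \<mu> (cball x 1)"
    (is "_ \<le> c ^ card {i. i < I \<and> ?L i} * _")
proof (induction I)
  case (Suc I)
  show ?case
  proof (cases "?L I")
    case True
    then have "{i. i < Suc I \<and> ?L i} = insert I {i. i < I \<and> ?L i}" by (auto simp: less_Suc_eq)
    then have card: "card {i. i < Suc I \<and> ?L i} = Suc (card {i. i < I \<and> ?L i})" by simp
    have "\<mu> (cball x (1 / 2 ^ (Suc I * K))) \<le> c * \<mu> (cball x (1 / 2 ^ (I * K)))" by (rule True)
    also have "\<dots> \<le> c * (c ^ card {i. i < I \<and> ?L i} * \<mu> (cball x 1))"
      by (rule mult_left_mono[OF Suc.IH]) simp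
    finally show ?thesis unfolding card by (simp only: power_Suc mult.assoc)
  next
    case False
    then have card: "{i. i < Suc I \<and> ?L i} = {i. i < I \<and> ?L i}" by (auto simp: less_Suc_eq)
    have "(2::real) ^ (I * K) \<le> 2 ^ (Suc I * K)" by (intro power_increasing) auto
    then have "cball x (1 / 2 ^ (Suc I * K)) \<subseteq> cball x (1 / 2 ^ (I * K))"
      by (intro subset_cball) (simp add: frac_le)
    then have "\<mu> (cball x (1 / 2 ^ (Suc I * K))) \<le> \<mu> (cball x (1 / 2 ^ (I * K)))"
      by (rule outer_mono[OF \<mu>])
    also note Suc.IH
    finally show ?thesis unfolding card .
  qed
qed simp

section \<open>Measure of the exceptional sets\<close>

text \<open>The offset 2 in the exponents is the closeness that \<open>dist_le_of_bad_type\<close>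
  demands of the points of one cell.\<close>

lemma scale_step:
  fixes A :: "'a::metric_space set"
  assumes "\<And>D (A :: 'a set). 0 < D \<Longrightarrow> \<forall>x\<in>A. \<forall>y\<in>A. dist x y \<le> D \<Longrightarrow> covered G (1 / 2 ^ K * D) A"
    and "\<forall>x\<in>A. \<forall>y\<in>A. dist x y \<le> 1 / 2 ^ (i * K + 2)"
  shows "covered G (1 / 2 ^ (Suc i * K + 2)) A"
proof -
  have "1 / 2 ^ K * (1 / 2 ^ (i * K + 2)) = (1 / 2 ^ (Suc i * K + 2) :: real)"
    by (simp add: power_add)
  moreover have "covered G (1 / 2 ^ K * (1 / 2 ^ (i * K + 2))) A"
    by (rule assms(1)[OF _ assms(2)]) simp
  ultimately show ?thesis by (simp only:)
qed

text \<open>The crude count: about \<open>G ^ N\<close> cells against balls of mass at most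
  \<open>c powr (p * N) * M\<close>. The hypothesis on \<open>c\<close> makes the product decay like
  \<open>(1 / 2) ^ N\<close>.\<close>

lemma mass_many_light_blocks:
  fixes \<mu> :: "'a::metric_space set \<Rightarrow> ennreal"
  assumes \<mu>: "outer_measure_space (Pow UNIV) \<mu>" and M: "\<mu> UNIV \<le> ennreal M" "0 \<le> M"
    and base: "covered n0 (1 / 4) S"
    and free: "\<And>D (A :: 'a set). 0 < D \<Longrightarrow> \<forall>x\<in>A. \<forall>y\<in>A. dist x y \<le> D \<Longrightarrow> covered G (1 / 2 ^ K * D) A"
    and G: "G \<ge> 1" and c: "0 < c" "c \<le> 1" "c powr p * real G \<le> 1 / 2" and IN: "I \<le> N"
  shows "\<mu> {x \<in> S. p * real N \<le> real (card {i. i < I \<and>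
      \<mu> (cball x (1 / 2 ^ (Suc i * K))) \<le> ennreal c * \<mu> (cball x (1 / 2 ^ (i * K)))})}
    \<le> ennreal (real n0 * M * (1 / 2) ^ N)"
    (is "\<mu> {x \<in> S. _ \<le> real (card {i. i < I \<and> ?L x i})} \<le> _")
proof -
  define A where "A = {x \<in> S. p * real N \<le> real (card {i. i < I \<and> ?L x i})}"
  \<comment> \<open>With an empty set of types every step is free, and the budget \<open>I\<close>
    is never exceeded.\<close>
  have "covered (n0 * ((card ({} :: unit set) + 1) * 1) ^ I * G ^ I) (1 / 2 ^ (I * K + 2))
      {x \<in> S. card {i. i < I \<and> (None :: unit option) = None} \<le> I}"
    by (rule covered_few_free_steps[where D = "\<lambda>i. 1 / 2 ^ (i * K + 2)"])
      (use base scale_step[OF free] G in auto)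
  then have cov: "covered (n0 * G ^ I) (1 / 2 ^ (I * K + 2)) A"
    by (rule covered_mono) (auto simp: A_def)
  have mass: "\<mu> (cball x (1 / 2 ^ (I * K + 2))) \<le> ennreal (c powr (p * real N) * M)" if "x \<in> A" for x
  proof -
    let ?k = "card {i. i < I \<and> ?L x i}"
    have "\<mu> (cball x (1 / 2 ^ (I * K + 2))) \<le> \<mu> (cball x (1 / 2 ^ (I * K)))"
      by (intro outer_mono[OF \<mu>] subset_cball frac_le power_increasing) auto
    also have "\<dots> \<le> ennreal c ^ ?k * \<mu> (cball x 1)"
      by (rule mass_le_of_light_blocks[OF \<mu>])
    also have "\<dots> \<le> ennreal c ^ ?k * ennreal M"
      by (intro mult_left_mono order_trans[OF outer_mono[OF \<mu>] M(1)]) auto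
    also have "\<dots> = ennreal (c powr real ?k * M)"
      using c(1) M(2) by (simp add: ennreal_power ennreal_mult powr_realpow)
    also have "\<dots> \<le> ennreal (c powr (p * real N) * M)"
      using that c(1,2) M(2)
      by (intro ennreal_leI mult_right_mono powr_mono') (auto simp: A_def)
    finally show ?thesis .
  qed
  have "\<mu> A \<le> of_nat (n0 * G ^ I) * ennreal (c powr (p * real N) * M)"
    by (rule outer_covered_le[OF \<mu> cov mass])
  also have "\<dots> = ennreal (real (n0 * G ^ I) * (c powr (p * real N) * M))"
    by (simp add: ennreal_of_nat_eq_real_of_nat ennreal_mult' del: of_nat_mult of_nat_power)
  also have "\<dots> \<le> ennreal (real n0 * M * (1 / 2) ^ N)"
  proof (rule ennreal_leI)
    have "real (G ^ I) * c powr (p * real N) \<le> real (G ^ N) * c powr (p * real N)"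
      using G IN by (intro mult_right_mono) (auto intro: power_increasing simp flip: of_nat_power)
    also have "\<dots> = (c powr p * real G) ^ N"
      using c(1) by (simp add: power_mult_distrib powr_powr flip: powr_realpow)
    also have "\<dots> \<le> (1 / 2) ^ N"
      using c by (intro power_mono) auto
    finally have "real n0 * M * (real (G ^ I) * c powr (p * real N)) \<le> real n0 * M * (1 / 2) ^ N"
      using M(2) by (intro mult_left_mono) auto
    then show "real (n0 * G ^ I) * (c powr (p * real N) * M) \<le> real n0 * M * (1 / 2) ^ N"
      by (simp add: mult_ac)
  qed
  finally show ?thesis by (simp add: A_def)
qed

text \<open>Outside the set \<open>L\<close> of points with many light blocks, at most
  \<open>2 * p * N\<close> blocks are light or good. The remaining points need, up to a constant,
  \<open>2 powr ((m + \<epsilon>) * N)\<close> cells from typed blocks times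
  \<open>2 powr (\<epsilon> * N)\<close> from free ones; ball masses of
  \<open>2 powr (- (m + 3 * \<epsilon>) * N)\<close> leave the decay
  \<open>2 powr (- \<epsilon> * N)\<close>.\<close>

lemma mass_bad_points:
  fixes \<mu> :: "(real^'n) set \<Rightarrow> ennreal" and C :: "(real^'n) set"
  assumes \<mu>: "outer_measure_space (Pow UNIV) \<mu>" and M: "\<mu> UNIV \<le> ennreal M" "0 \<le> M"
    and base: "covered n0 (1 / 4) (measure_support \<mu>)"
    and m: "0 < m" "m \<le> CARD('n)" and \<alpha>: "0 < \<alpha>" "\<alpha> < 1" and \<tau>: "\<tau> = \<alpha> / (12 * real m)"
    and C: "finite C" "C \<subseteq> cball 0 1" "\<And>u. norm u \<le> 1 \<Longrightarrow> \<exists>c\<in>C. norm (c - u) \<le> \<tau>"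
    and n: "n \<ge> 1" "\<And>D (S :: (real^'n) set). 0 < D \<Longrightarrow> \<forall>x\<in>S. \<forall>y\<in>S. dist x y \<le> D \<Longrightarrow> covered n (\<tau> / 4 * D) S"
    and K: "2 \<le> K" "real ((card C ^ m * card C + 1) * ((2 * 2 ^ K + 1) ^ m * n)) \<le> 2 powr (real K * (real m + \<epsilon>))"
    and G: "G \<ge> 1" "\<And>D (A :: (real^'n) set). 0 < D \<Longrightarrow> \<forall>x\<in>A. \<forall>y\<in>A. dist x y \<le> D \<Longrightarrow> covered G (1 / 2 ^ K * D) A"
    and \<epsilon>: "0 < \<epsilon>" and p: "0 < p" "real G powr (2 * p) \<le> 2 powr \<epsilon>"
    and c: "0 < c" "c \<le> 1" "c powr p * real G \<le> 1 / 2"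
  shows "\<mu> {x \<in> measure_support \<mu>. \<mu> (cball x (1 / 2 ^ N)) \<le> ennreal (2 powr (- (real m + 3 * \<epsilon>) * real N)) \<and>
      real (card {k \<in> {1..N}. cone_density \<mu> m \<alpha> x k > ennreal (c / 2)}) < p * real N}
    \<le> ennreal (real n0 * real G * (2 powr - \<epsilon>) ^ N + real n0 * M * (1 / 2) ^ N)"
    (is "\<mu> ?E \<le> _")
proof -
  define S where "S = measure_support \<mu>"
  define I where "I = N div K"
  have IK: "I * K \<le> N" "N < Suc I * K" and IN: "I \<le> N"
    using K(1) dividend_less_div_times[of K N] by (auto simp: I_def)
  define light where "light x i \<longleftrightarrow>
    \<mu> (cball x (1 / 2 ^ (Suc i * K))) \<le> ennreal c * \<mu> (cball x (1 / 2 ^ (i * K)))" for x i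
  define good where "good x i \<longleftrightarrow> ennreal (c / 2) < cone_density \<mu> m \<alpha> x (Suc (i * K))" for x i
  define T where "T = {qs. set qs \<subseteq> C \<and> length qs = m} \<times> C"
  define W where "W = (2 * 2 ^ K + 1) ^ m * n"
  define g where "g = nat \<lfloor>2 * p * real N\<rfloor>"
  have finT: "finite T" unfolding T_def using C(1) by (intro finite_cartesian_product finite_lists_length_eq)
  have cardT: "card T = card C ^ m * card C"
    unfolding T_def by (simp add: card_cartesian_product card_lists_length_eq[OF C(1)])
  have W1: "W \<ge> 1" using n(1) by (simp add: W_def)
  have ex: "\<exists>t\<in>T. bad_type \<mu> m \<alpha> \<tau> (ennreal c) x (Suc (i * K)) t" if "x \<in> S" "\<not> good x i" for x i
    unfolding T_def
  proof (rule bad_type_exists[OF m(2)])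
    \<comment> \<open>The gap between \<open>c / 2\<close> and \<open>c\<close> turns the non-strict
      bound at a block that is not good into the strict one that extracts a cone from the
      infimum.\<close>
    have "ennreal (c / 2) < ennreal c" using c(1) by (simp add: ennreal_less_iff)
    then show "cone_density \<mu> m \<alpha> x (Suc (i * K)) < ennreal c"
      using that(2) unfolding good_def by (meson le_less_trans not_less)
    show "\<mu> (cball x (1 / 2 ^ Suc (i * K))) \<noteq> 0"
    proof -
      have "0 < (1 / 2 ^ Suc (i * K) :: real)" by simp
      then show ?thesis using that(1) unfolding S_def measure_support_def by (metis (mono_tags, lifting) less_irrefl mem_Collect_eq)
    qed
    show "\<mu> (cball x (1 / 2 ^ Suc (i * K))) < top"
      using outer_mono[OF \<mu> subset_UNIV] M(1) by (meson ennreal_less_top le_less_trans)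
  qed (rule C(3))
  \<comment> \<open>Nothing is recorded at light or good blocks; at the others a nearly empty cone
    exists, and one of its finitely many approximate descriptions is fixed.\<close>
  define ty where "ty i x = (if light x i \<or> good x i then None
    else Some (SOME t. t \<in> T \<and> bad_type \<mu> m \<alpha> \<tau> (ennreal c) x (Suc (i * K)) t))" for i x
  have some: "t \<in> T \<and> bad_type \<mu> m \<alpha> \<tau> (ennreal c) x (Suc (i * K)) t"
    if "x \<in> S" "ty i x = Some t" for i x t
  proof -
    have good: "\<not> good x i" and t: "t = (SOME t. t \<in> T \<and> bad_type \<mu> m \<alpha> \<tau> (ennreal c) x (Suc (i * K)) t)"
      using that(2) by (auto simp: ty_def split: if_splits)
    have "\<exists>t. t \<in> T \<and> bad_type \<mu> m \<alpha> \<tau> (ennreal c) x (Suc (i * K)) t"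
      using ex[OF that(1) good] by blast
    from someI_ex[OF this] show ?thesis unfolding t .
  qed
  have "covered (n0 * ((card T + 1) * W) ^ I * G ^ g) (1 / 2 ^ (I * K + 2))
      {x \<in> S. card {i. i < I \<and> ty i x = None} \<le> g}"
  proof (rule covered_few_free_steps[where D = "\<lambda>i. 1 / 2 ^ (i * K + 2)", OF _ _ _ finT _ G(1) W1])
    show "covered n0 (1 / 2 ^ (0 * K + 2)) S" using base by (simp add: S_def)
    show "covered G (1 / 2 ^ (Suc i * K + 2)) A"
      if "\<forall>x\<in>A. \<forall>y\<in>A. dist x y \<le> 1 / 2 ^ (i * K + 2)" for i and A :: "(real^'n) set"
      by (rule scale_step[OF G(2) that])
    show "ty i x \<in> insert None (Some ` T)" if "x \<in> S" for i x
      using some[OF that, of i] by (cases "ty i x") auto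
    show "covered W (1 / 2 ^ (Suc i * K + 2)) A"
      if tT: "t \<in> T" and AS: "A \<subseteq> S" and near: "\<forall>x\<in>A. \<forall>y\<in>A. dist x y \<le> 1 / 2 ^ (i * K + 2)"
        and ty: "\<forall>x\<in>A. ty i x = Some t" for i A t
    proof -
      have "covered W (1 / 2 ^ (i * K + K + 2)) A"
        unfolding W_def
      proof (rule typed_cell_covered[OF \<mu> m(1) \<alpha> \<tau> K(1) n(2) _ _ _ _ near])
        show "length (fst t) = m" "set (fst t) \<subseteq> cball 0 1"
          using tT C(2) by (auto simp: T_def)
        fix x assume x: "x \<in> A"
        then show "bad_type \<mu> m \<alpha> \<tau> (ennreal c) x (Suc (i * K)) t"
          using some AS ty by blast
        have "\<not> light x i" using ty x by (auto simp: ty_def split: if_splits)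
        then show "ennreal c * \<mu> (cball x (1 / 2 ^ (i * K))) < \<mu> (cball x (1 / 2 ^ (i * K + K)))"
          by (simp add: light_def not_le add.commute)
      qed
      then show ?thesis by (simp add: add.commute)
    qed
  qed
  \<comment> \<open>One extra free block bridges the fewer than \<open>K\<close> scales between
    \<open>I * K\<close> and \<open>N\<close>.\<close>
  then have "covered (n0 * ((card T + 1) * W) ^ I * G ^ g * G) (1 / 2 ^ (Suc I * K + 2))
      {x \<in> S. card {i. i < I \<and> ty i x = None} \<le> g}"
    by (rule covered_refine) (rule scale_step[OF G(2)])
  then have cov: "covered (n0 * ((card T + 1) * W) ^ I * G ^ g * G) (1 / 2 ^ N)
      {x \<in> S. card {i. i < I \<and> ty i x = None} \<le> g}"
  proof (rule covered_mono)
    show "1 / 2 ^ (Suc I * K + 2) \<le> (1 / 2 ^ N :: real)"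
      using IK(2) by (intro frac_le power_increasing) auto
  qed auto
  define L where "L = {x \<in> S. p * real N \<le> real (card {i. i < I \<and> light x i})}"
  have \<mu>L: "\<mu> L \<le> ennreal (real n0 * M * (1 / 2) ^ N)"
    unfolding L_def light_def S_def
    by (rule mass_many_light_blocks[OF \<mu> M base G(2,1) c IN])
  have few: "card {i. i < I \<and> ty i x = None} \<le> g" if "x \<in> ?E - L" for x
  proof -
    have "{i. i < I \<and> ty i x = None} \<subseteq> {i. i < I \<and> light x i} \<union> {i. i < I \<and> good x i}"
      by (auto simp: ty_def split: if_splits)
    then have "card {i. i < I \<and> ty i x = None} \<le> card ({i. i < I \<and> light x i} \<union> {i. i < I \<and> good x i})"
      by (intro card_mono) auto
    also have "\<dots> \<le> card {i. i < I \<and> light x i} + card {i. i < I \<and> good x i}"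
      by (rule card_Un_le)
    finally have 1: "real (card {i. i < I \<and> ty i x = None}) \<le>
      real (card {i. i < I \<and> light x i}) + real (card {i. i < I \<and> good x i})" by linarith
    \<comment> \<open>Distinct good blocks \<open>i\<close> supply distinct scales
      \<open>Suc (i * K)\<close>, all in \<open>{1..N}\<close> because
      \<open>Suc i * K \<le> I * K \<le> N\<close>.\<close>
    have 2: "card {i. i < I \<and> good x i} \<le> card {k \<in> {1..N}. cone_density \<mu> m \<alpha> x k > ennreal (c / 2)}"
    proof (rule card_inj_on_le)
      show "inj_on (\<lambda>i. Suc (i * K)) {i. i < I \<and> good x i}"
        using K(1) by (auto simp: inj_on_def)
      show "(\<lambda>i. Suc (i * K)) ` {i. i < I \<and> good x i} \<subseteq> {k \<in> {1..N}. cone_density \<mu> m \<alpha> x k > ennreal (c / 2)}"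
      proof safe
        fix i assume i: "i < I" "good x i"
        then have "Suc i * K \<le> I * K" by (intro mult_right_mono) auto
        then show "Suc (i * K) \<in> {1..N}" using IK(1) K(1) by simp
        show "cone_density \<mu> m \<alpha> x (Suc (i * K)) > ennreal (c / 2)" using i by (simp add: good_def)
      qed
    qed simp
    have "real (card {i. i < I \<and> light x i}) < p * real N"
      using that by (auto simp: L_def S_def)
    moreover have "real (card {k \<in> {1..N}. cone_density \<mu> m \<alpha> x k > ennreal (c / 2)}) < p * real N"
      using that by auto
    ultimately have "real (card {i. i < I \<and> ty i x = None}) \<le> 2 * p * real N"
      using 1 2 by linarith
    then show ?thesis unfolding g_def by (rule le_nat_floor)
  qed
  define b where "b = 2 powr (- (real m + 3 * \<epsilon>) * real N)"
  have "\<mu> (?E - L) \<le> of_nat (n0 * ((card T + 1) * W) ^ I * G ^ g * G) * ennreal b"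
  proof (rule outer_covered_le[OF \<mu>])
    show "covered (n0 * ((card T + 1) * W) ^ I * G ^ g * G) (1 / 2 ^ N) (?E - L)"
      by (rule covered_mono[OF cov]) (use few in \<open>auto simp: S_def\<close>)
  qed (simp add: b_def)
  also have "\<dots> = ennreal (real (n0 * ((card T + 1) * W) ^ I * G ^ g * G) * b)"
    by (simp add: ennreal_of_nat_eq_real_of_nat ennreal_mult' b_def del: of_nat_mult of_nat_power)
  also have "\<dots> \<le> ennreal (real n0 * real G * (2 powr - \<epsilon>) ^ N)"
  proof (rule ennreal_leI)
    have "real ((card T + 1) * W) ^ I \<le> (2 powr (real K * (real m + \<epsilon>))) ^ I"
      using K(2) by (intro power_mono) (simp_all add: W_def cardT)
    also have "\<dots> = 2 powr ((real m + \<epsilon>) * real (I * K))"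
      by (simp add: powr_powr mult_ac flip: powr_realpow)
    also have "\<dots> \<le> 2 powr ((real m + \<epsilon>) * real N)"
      using IK(1) \<epsilon> by (intro powr_mono mult_left_mono) (auto simp flip: of_nat_mult)
    finally have 1: "real ((card T + 1) * W) ^ I \<le> 2 powr ((real m + \<epsilon>) * real N)" .
    have "real G ^ g = real G powr real g"
      using G(1) by (simp add: powr_realpow)
    also have "\<dots> \<le> real G powr (2 * p * real N)"
      using G(1) p(1) by (intro powr_mono) (auto simp: g_def)
    also have "\<dots> = (real G powr (2 * p)) powr real N"
      by (simp add: powr_powr)
    also have "\<dots> \<le> (2 powr \<epsilon>) powr real N"
      using p(2) by (intro powr_mono2) auto
    also have "\<dots> = 2 powr (\<epsilon> * real N)"
      by (simp add: powr_powr)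
    finally have 2: "real G ^ g \<le> 2 powr (\<epsilon> * real N)" .
    have "real ((card T + 1) * W) ^ I * real G ^ g * b
      \<le> 2 powr ((real m + \<epsilon>) * real N) * 2 powr (\<epsilon> * real N) * b"
      by (intro mult_mono 1 2) (auto simp: b_def)
    also have "\<dots> = 2 powr ((real m + \<epsilon>) * real N + \<epsilon> * real N + - (real m + 3 * \<epsilon>) * real N)"
      unfolding b_def by (simp only: powr_add)
    also have "\<dots> = (2 powr - \<epsilon>) ^ N"
      by (simp add: powr_powr algebra_simps flip: powr_realpow)
    finally have "real n0 * real G * (real ((card T + 1) * W) ^ I * real G ^ g * b)
      \<le> real n0 * real G * (2 powr - \<epsilon>) ^ N"
      by (intro mult_left_mono) auto
    then show "real (n0 * ((card T + 1) * W) ^ I * G ^ g * G) * b \<le> real n0 * real G * (2 powr - \<epsilon>) ^ N"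
      by (simp only: of_nat_mult of_nat_power mult_ac)
  qed
  finally have EL: "\<mu> (?E - L) \<le> ennreal (real n0 * real G * (2 powr - \<epsilon>) ^ N)" .
  have "\<mu> ?E \<le> \<mu> ((?E - L) \<union> L)" by (rule outer_mono[OF \<mu>]) blast
  also have "\<dots> \<le> \<mu> (?E - L) + \<mu> L" by (rule outer_Un[OF \<mu>])
  also have "\<dots> \<le> ennreal (real n0 * real G * (2 powr - \<epsilon>) ^ N) + ennreal (real n0 * M * (1 / 2) ^ N)"
    by (rule add_mono[OF EL \<mu>L])
  also have "\<dots> = ennreal (real n0 * real G * (2 powr - \<epsilon>) ^ N + real n0 * M * (1 / 2) ^ N)"
    using M(2) by (intro ennreal_plus[symmetric]) auto
  finally show ?thesis .
qed

section \<open>Local dimensions\<close>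

text \<open>Multiplication by \<open>ln r < 0\<close> reverses the inequality. Infinite mass would
  give the quotient \<open>-\<infinity>\<close>, which the hypothesis excludes; zero mass is
  trivial.\<close>

lemma mass_le_of_quotient:
  assumes r: "0 < r" "r < 1" and quot: "ereal s < ennreal_ln u / ereal (ln r)"
  shows "u \<le> ennreal (r powr s)"
proof -
  have ln: "ln r < 0" using r by simp
  consider "u = 0" | "u = top" | v where "0 < v" "u = ennreal v"
    by (cases u) (auto simp: less_le)
  then show ?thesis
  proof cases
    case 2
    then have "ennreal_ln u / ereal (ln r) = -\<infinity>"
      using ln by (simp add: ennreal_ln_def)
    then show ?thesis using quot by simp
  next
    case (3 v)
    then have "ennreal_ln u = ereal (ln v)"
      by (simp add: ennreal_ln_def)
    then have "s < ln v / ln r" using quot ln by simp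
    then have "ln v < s * ln r" using ln by (simp add: neg_less_divide_eq)
    then have "v \<le> r powr s"
      using 3(1) r(1) by (metis exp_ln exp_less_mono less_eq_real_def not_less_iff_gr_or_eq powr_def order_less_irrefl)
    then show ?thesis using 3(2) by (simp add: ennreal_leI)
  qed simp
qed

lemma eventually_at_right_0_less_1: "\<forall>\<^sub>F r in at_right 0. 0 < r \<and> r < (1::real)"
  unfolding eventually_at_right_field by (rule exI[of _ 1]) auto

lemma Omega_lower_mass:
  fixes \<mu> :: "(real^'n) set \<Rightarrow> ennreal"
  assumes x: "x \<in> Omega_lower s \<mu>" and "t < s"
  shows "\<forall>\<^sub>F N in sequentially. \<mu> (cball x (1 / 2 ^ N)) \<le> ennreal (2 powr (- t * real N))"
proof -
  have "\<forall>\<^sub>F r in at_right 0. ereal t < ennreal_ln (\<mu> (cball x r)) / ereal (ln r)"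
    using x \<open>t < s\<close> unfolding Omega_lower_def lower_local_dim_def le_Liminf_iff by auto
  with eventually_at_right_0_less_1
  have ev: "\<forall>\<^sub>F r in at_right 0. \<mu> (cball x r) \<le> ennreal (r powr t)"
    by eventually_elim (auto intro: mass_le_of_quotient)
  have "filterlim (\<lambda>N. 1 / 2 ^ N :: real) (at_right 0) sequentially"
  proof (rule tendsto_imp_filterlim_at_right)
    show "(\<lambda>N. 1 / 2 ^ N :: real) \<longlonglongrightarrow> 0"
      using LIMSEQ_realpow_zero[of "1/2::real"] by (simp add: power_one_over)
  qed simp
  from eventually_compose_filterlim[OF ev this]
  show ?thesis
  proof eventually_elim
    case (elim N)
    have "(1 / 2 ^ N :: real) powr t = 2 powr (- t * real N)"
      by (simp add: powr_divide powr_minus_divide powr_powr mult.commute flip: powr_realpow)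
    then show ?case using elim by simp
  qed
qed

text \<open>The limsup supplies arbitrarily small radii \<open>r\<close> that need not be dyadic.
  Passing to the largest dyadic radius below \<open>r\<close> costs at most a factor
  \<open>2 powr u\<close>, absorbed by the gap between \<open>t\<close> and \<open>u\<close> once
  \<open>N\<close> is large.\<close>

lemma Omega_upper_mass:
  fixes \<mu> :: "(real^'n) set \<Rightarrow> ennreal"
  assumes \<mu>: "outer_measure_space (Pow UNIV) \<mu>"
    and x: "x \<in> Omega_upper s \<mu>" and t: "0 < t" "t < s"
  shows "\<exists>\<^sub>F N in sequentially. \<mu> (cball x (1 / 2 ^ N)) \<le> ennreal (2 powr (- t * real N))"
  unfolding frequently_sequentially
proof
  fix N0
  define u where "u = (t + s) / 2"
  have u: "t < u" "u < s" "0 < u" using t by (auto simp: u_def)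
  \<comment> \<open>For \<open>N > N1\<close> this gives \<open>u < N * (u - t)\<close>, which is
    the final comparison of exponents rearranged.\<close>
  obtain N1 :: nat where N1: "real N1 > u / (u - t)" "N1 \<ge> N0"
    by (meson le_max_iff_disj max.cobounded2 reals_Archimedean2 less_le_trans of_nat_le_iff max.cobounded1)
  have "\<exists>\<^sub>F r in at_right 0. ereal u < ennreal_ln (\<mu> (cball x r)) / ereal (ln r)"
  proof (rule ccontr)
    assume "\<not> ?thesis"
    then have "upper_local_dim \<mu> x \<le> ereal u"
      unfolding upper_local_dim_def not_frequently by (intro Limsup_bounded) (simp add: not_less)
    moreover have "ereal s \<le> upper_local_dim \<mu> x" using x by (simp add: Omega_upper_def)
    ultimately show False using u(2) by (meson ereal_less_eq(3) not_less order_trans)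
  qed
  moreover have "\<forall>\<^sub>F r in at_right 0. 0 < r \<and> r < (1 / 2 ^ N1 :: real)"
    unfolding eventually_at_right_field by (rule exI[of _ "1 / 2 ^ N1"]) auto
  ultimately have "\<exists>\<^sub>F r in at_right 0. ereal u < ennreal_ln (\<mu> (cball x r)) / ereal (ln r)
      \<and> 0 < r \<and> r < (1 / 2 ^ N1 :: real)"
    by (rule frequently_eventually_frequently)
  then obtain r where r: "0 < r" "r < 1 / 2 ^ N1" "ereal u < ennreal_ln (\<mu> (cball x r)) / ereal (ln r)"
    using frequently_ex by blast
  have "1 / 2 ^ N1 \<le> (1::real)" by simp
  then have "r < 1" using r(2) by linarith
  from mass_le_of_quotient[OF r(1) this r(3)] have mass: "\<mu> (cball x r) \<le> ennreal (r powr u)" .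
  have "\<exists>n. 1 / 2 ^ n \<le> r"
    using real_arch_pow_inv[of r "1/2"] r(1) by (auto simp: power_one_over intro: less_imp_le)
  \<comment> \<open>Minimality yields \<open>r < 1 / 2 ^ (N - 1)\<close>, so \<open>r\<close> and
    \<open>1 / 2 ^ N\<close> differ by less than a factor 2.\<close>
  define N where "N = (LEAST n. 1 / 2 ^ n \<le> r)"
  have N: "1 / 2 ^ N \<le> r"
    unfolding N_def using \<open>\<exists>n. 1 / 2 ^ n \<le> r\<close> by (rule LeastI_ex)
  have "N1 < N"
  proof (rule ccontr)
    assume "\<not> N1 < N"
    then have "1 / 2 ^ N1 \<le> (1 / 2 ^ N :: real)" by (intro frac_le power_increasing) auto
    then show False using N r(2) by linarith
  qed
  then obtain N' where N': "N = Suc N'" by (cases N) auto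
  then have "\<not> 1 / 2 ^ N' \<le> r"
    unfolding N_def using not_less_Least[of N' "\<lambda>n. 1 / 2 ^ n \<le> r"] by auto
  then have rN: "r \<le> 2 powr (1 - real N)"
    by (simp add: N' powr_minus_divide powr_realpow)
  have "\<mu> (cball x (1 / 2 ^ N)) \<le> \<mu> (cball x r)"
    using N by (intro outer_mono[OF \<mu>] subset_cball)
  also note mass
  also have "ennreal (r powr u) \<le> ennreal (2 powr (- t * real N))"
  proof (rule ennreal_leI)
    have "r powr u \<le> (2 powr (1 - real N)) powr u"
      using r(1) u(3) rN by (intro powr_mono2) auto
    also have "\<dots> = 2 powr ((1 - real N) * u)"
      by (simp add: powr_powr)
    also have "\<dots> \<le> 2 powr (- t * real N)"
    proof (rule powr_mono)
      have "u / (u - t) < real N" using N1(1) \<open>N1 < N\<close> by (meson less_trans of_nat_less_iff)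
      then have "u < real N * (u - t)" using u(1) by (simp add: pos_divide_less_eq)
      then show "(1 - real N) * u \<le> - t * real N" by (simp add: algebra_simps)
    qed simp
    finally show "r powr u \<le> 2 powr (- t * real N)" .
  qed
  finally show "\<exists>n\<ge>N0. \<mu> (cball x (1 / 2 ^ n)) \<le> ennreal (2 powr (- t * real n))"
    using \<open>N1 < N\<close> N1(2) by (intro exI[of _ N]) auto
qed

section \<open>Choice of the constants and Borel--Cantelli\<close>

lemma block_length_exists:
  fixes T m n :: nat
  assumes "0 < \<epsilon>"
  obtains K where "2 \<le> K" "real (T * ((2 * 2 ^ K + 1) ^ m * n)) \<le> 2 powr (real K * (real m + \<epsilon>))"
proof -
  \<comment> \<open>\<open>X\<close> collects the cost per block that does not grow with
    \<open>K\<close>, the factor \<open>4 ^ m\<close> coming from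
    \<open>2 * 2 ^ K + 1 \<le> 4 * 2 ^ K\<close>. A long block makes it smaller than
    \<open>2 powr (K * \<epsilon>)\<close>.\<close>
  define X where "X = real T * real n * 4 ^ m"
  obtain k :: nat where k: "X < (2 powr \<epsilon>) ^ k"
    using real_arch_pow[of "2 powr \<epsilon>" X] assms by auto
  define K where "K = max 2 k"
  have "(2 powr \<epsilon>) ^ k \<le> (2 powr \<epsilon>) ^ K"
    using assms by (intro power_increasing ge_one_powr_ge_zero) (auto simp: K_def)
  then have X: "X \<le> 2 powr (real K * \<epsilon>)"
    using order.trans[OF less_imp_le[OF k]] by (simp add: powr_powr mult.commute flip: powr_realpow)
  have "real ((2 * 2 ^ K + 1) ^ m) \<le> (4 * 2 ^ K) ^ m"
  proof -
    have "(1::real) \<le> 2 ^ K" by simp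
    then have "(2 * 2 ^ K + 1 :: real) \<le> 4 * 2 ^ K" by linarith
    then have "(2 * 2 ^ K + 1 :: real) ^ m \<le> (4 * 2 ^ K) ^ m" by (rule power_mono) simp
    then show ?thesis by (simp only: of_nat_power of_nat_add of_nat_mult of_nat_numeral of_nat_1)
  qed
  also have "\<dots> = 4 ^ m * 2 powr (real K * real m)"
    by (simp add: power_mult_distrib powr_realpow flip: of_nat_mult power_mult)
  finally have "real T * real n * real ((2 * 2 ^ K + 1) ^ m)
      \<le> real T * real n * (4 ^ m * 2 powr (real K * real m))"
    by (intro mult_left_mono) auto
  also have "\<dots> = X * 2 powr (real K * real m)"
    by (simp add: X_def)
  also have "\<dots> \<le> 2 powr (real K * \<epsilon>) * 2 powr (real K * real m)"
    by (intro mult_right_mono X) auto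
  also have "\<dots> = 2 powr (real K * (real m + \<epsilon>))"
    by (simp add: algebra_simps flip: powr_add)
  finally show thesis
    by (intro that[of K]) (simp_all add: K_def mult_ac)
qed

theorem theorem1p2:
  fixes m :: nat and s \<alpha> :: real
  assumes "0 < m" and "real m < s" and "s < real CARD('n::finite)"
    and "0 < \<alpha>" and "\<alpha> < 1"
  shows "\<exists>p::real. \<exists>c::real. p > 0 \<and> c > 0 \<and>
    (\<forall>\<mu> :: (real^'n) set \<Rightarrow> ennreal. compact_borel_regular_measure \<mu> \<longrightarrow>
       ae_on \<mu> (Omega_lower s \<mu>) (\<lambda>x. \<forall>\<^sub>F N in sequentially.
         p * real N \<le> real (card {k \<in> {1..N}. cone_density \<mu> m \<alpha> x k > ennreal c})) \<and>
       ae_on \<mu> (Omega_upper s \<mu>) (\<lambda>x. \<exists>\<^sub>F N in sequentially.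
         p * real N \<le> real (card {k \<in> {1..N}. cone_density \<mu> m \<alpha> x k > ennreal c})))"
proof -
  define \<tau> where "\<tau> = \<alpha> / (12 * real m)"
  have \<tau>0: "0 < \<tau>" using assms by (simp add: \<tau>_def)
  \<comment> \<open>A quarter of the gap: one \<open>\<epsilon>\<close> each for the typed blocks,
    the free blocks and the geometric decay, the last keeping \<open>m + 3 * \<epsilon>\<close>
    strictly below \<open>s\<close>.\<close>
  define \<epsilon> where "\<epsilon> = (s - real m) / 4"
  have \<epsilon>: "0 < \<epsilon>" "real m + 3 * \<epsilon> < s" "0 < real m + 3 * \<epsilon>"
    using assms by (auto simp: \<epsilon>_def field_simps)
  obtain C :: "(real^'n) set" where C: "finite C" "C \<subseteq> cball 0 1"
    "\<And>u. norm u \<le> 1 \<Longrightarrow> \<exists>c\<in>C. norm (c - u) \<le> \<tau>"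
    by (rule finite_net[OF \<tau>0]) blast
  have "0 < \<tau> / 4" using \<tau>0 by simp
  then obtain n where n: "n \<ge> 1" "\<And>D (S :: (real^'n) set). 0 < D \<Longrightarrow>
    \<forall>x\<in>S. \<forall>y\<in>S. dist x y \<le> D \<Longrightarrow> covered n (\<tau> / 4 * D) S"
    by (rule covered_scale) blast
  \<comment> \<open>The order of choices matters: \<open>\<tau>\<close>, \<open>C\<close> and
    \<open>n\<close> determine \<open>K\<close>, then \<open>K\<close> determines \<open>G\<close>,
    then \<open>G\<close> determines \<open>p\<close>, and finally \<open>c\<close>. All of them
    precede the measure.\<close>
  obtain K where K: "2 \<le> K" "real ((card C ^ m * card C + 1) * ((2 * 2 ^ K + 1) ^ m * n))
      \<le> 2 powr (real K * (real m + \<epsilon>))"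
    by (rule block_length_exists[OF \<epsilon>(1)])
  have "0 < (1 / 2 ^ K :: real)" by simp
  then obtain G where G: "G \<ge> 1" "\<And>D (S :: (real^'n) set). 0 < D \<Longrightarrow>
    \<forall>x\<in>S. \<forall>y\<in>S. dist x y \<le> D \<Longrightarrow> covered G (1 / 2 ^ K * D) S"
    by (rule covered_scale) blast
  \<comment> \<open>Makes \<open>2 * p * log 2 G \<le> \<epsilon>\<close>; the summand 1 keeps the
    denominator positive when \<open>G = 1\<close>.\<close>
  define p where "p = \<epsilon> / (2 * (log 2 (real G) + 1))"
  have lG: "0 \<le> log 2 (real G)" using G(1) by simp
  have p: "0 < p" using \<epsilon>(1) lG by (simp add: p_def)
  have Gp: "real G powr (2 * p) \<le> 2 powr \<epsilon>"
  proof -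
    have "real G powr (2 * p) = 2 powr (log 2 (real G) * (2 * p))"
      using G(1) by (simp flip: powr_powr)
    also have "log 2 (real G) * (2 * p) \<le> \<epsilon>"
      using lG \<epsilon>(1) by (simp add: p_def pos_divide_le_eq algebra_simps)
    finally show ?thesis by simp
  qed
  \<comment> \<open>The solution of \<open>c powr p * G = 1 / 2\<close>.\<close>
  define c where "c = (1 / (2 * real G)) powr (1 / p)"
  have c: "0 < c" "c \<le> 1" "c powr p * real G \<le> 1 / 2"
    using G(1) p by (auto simp: c_def powr_powr powr_le1)
  define few where "few \<mu> x N \<longleftrightarrow>
    real (card {k \<in> {1..N}. cone_density \<mu> m \<alpha> x k > ennreal (c / 2)}) < p * real N"
    for \<mu> :: "(real^'n) set \<Rightarrow> ennreal" and x N
  have main: "ae_on \<mu> (Omega_lower s \<mu>) (\<lambda>x. \<forall>\<^sub>F N in sequentially. \<not> few \<mu> x N) \<and>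
      ae_on \<mu> (Omega_upper s \<mu>) (\<lambda>x. \<exists>\<^sub>F N in sequentially. \<not> few \<mu> x N)"
    if cm: "compact_borel_regular_measure \<mu>" for \<mu> :: "(real^'n) set \<Rightarrow> ennreal"
  proof -
    have \<mu>: "outer_measure_space (Pow UNIV) \<mu>" and cs: "compact (measure_support \<mu>)"
      using cm by (auto simp: compact_borel_regular_measure_def)
    obtain M where M: "0 \<le> M" "\<mu> UNIV = ennreal M"
      using total_mass_finite[OF cm] by (cases "\<mu> UNIV") auto
    obtain n0 where n0: "covered n0 (1 / 4) (measure_support \<mu>)"
      using bounded_covered[OF compact_imp_bounded[OF cs], of "1 / 4"] by auto
    define small where "small x N \<longleftrightarrow> \<mu> (cball x (1 / 2 ^ N)) \<le> ennreal (2 powr (- (real m + 3 * \<epsilon>) * real N))" for x N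
    define E where "E N = {x \<in> measure_support \<mu>. small x N \<and> few \<mu> x N}" for N
    define h where "h N = real n0 * real G * (2 powr - \<epsilon>) ^ N + real n0 * M * (1 / 2) ^ N" for N :: nat
    have E: "\<mu> (E N) \<le> ennreal (h N)" for N
      unfolding E_def few_def h_def small_def
      by (rule mass_bad_points[OF \<mu> _ M(1) n0 assms(1) _ assms(4,5) \<tau>_def C n K G \<epsilon>(1) p Gp c])
        (use M assms in auto)
    have h: "summable h"
      unfolding h_def using powr_less_mono[of "- \<epsilon>" 0 2] \<epsilon>(1)
      by (intro summable_add summable_mult summable_geometric) auto
    have h0: "h N \<ge> 0" for N using M(1) by (simp add: h_def)
    have "(\<Sum>N. \<mu> (E N)) \<le> (\<Sum>N. ennreal (h N))"
      by (intro suminf_le E summableI)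
    also have "\<dots> = ennreal (\<Sum>N. h N)"
      by (rule suminf_ennreal2[OF h0 h])
    finally have "(\<Sum>N. \<mu> (E N)) \<noteq> top"
      by (auto simp: top_unique)
    from outer_limsup_null[OF \<mu> this]
    have null: "\<mu> (- measure_support \<mu> \<union> {x. \<exists>\<^sub>F N in sequentially. x \<in> E N}) = 0"
      using outer_Un[OF \<mu>, of "- measure_support \<mu>"] compl_support_null[OF cm] by (metis add_0 le_zero_eq)
    \<comment> \<open>A failing point lies in infinitely many \<open>E N\<close> in both cases, with
      the roles exchanged: for the lower dimension \<open>small\<close> holds eventually and
      \<open>few\<close> frequently, for the upper dimension \<open>small\<close> frequently and
      \<open>few\<close> eventually.\<close>
    have lower: "\<exists>\<^sub>F N in sequentially. x \<in> E N"
      if "x \<in> measure_support \<mu>" "x \<in> Omega_lower s \<mu>" "\<not> (\<forall>\<^sub>F N in sequentially. \<not> few \<mu> x N)" for x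
    proof -
      have "\<exists>\<^sub>F N in sequentially. few \<mu> x N" using that(3) by (simp add: frequently_def)
      from frequently_eventually_frequently[OF this Omega_lower_mass[OF that(2) \<epsilon>(2)]]
      show ?thesis
        by (rule frequently_mono[rotated]) (use that(1) in \<open>auto simp: E_def small_def\<close>)
    qed
    have upper: "\<exists>\<^sub>F N in sequentially. x \<in> E N"
      if "x \<in> measure_support \<mu>" "x \<in> Omega_upper s \<mu>" "\<not> (\<exists>\<^sub>F N in sequentially. \<not> few \<mu> x N)" for x
    proof -
      have "\<forall>\<^sub>F N in sequentially. few \<mu> x N" using that(3) by (simp add: frequently_def)
      from frequently_eventually_frequently[OF Omega_upper_mass[OF \<mu> that(2) \<epsilon>(3,2)] this]
      show ?thesis
        by (rule frequently_mono[rotated]) (use that(1) in \<open>auto simp: E_def small_def\<close>)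
    qed
    have zero: "\<mu> A = 0"
      if "A \<subseteq> - measure_support \<mu> \<union> {x. \<exists>\<^sub>F N in sequentially. x \<in> E N}" for A
      using outer_mono[OF \<mu> that] null by simp
    show ?thesis
      unfolding ae_on_def by (intro conjI zero) (use lower upper in blast)+
  qed
  show ?thesis
    \<comment> \<open>The witness is \<open>c / 2\<close>, the threshold in \<open>few\<close>,
      while \<open>c\<close> itself measures light blocks.\<close>
    using p c(1) main unfolding few_def not_less by (intro exI[of _ p] exI[of _ "c / 2"]) auto
qed

end
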